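(* The expected total number of broadcast attempts (transmissions of packets or control messages, successful or not, by all stations together) during the execution of algorithm AdaptiveNoK on $k$ stations is $O(k\log^2 k)$. The result holds even when the stations are activated by an adaptive adversary.
   Context: Model. $k$ anonymous identical stations share a channel. Time is divided into discrete synchronous rounds; there is no global clock and no collision detection. Initially all stations are asleep. Each station holds one packet and is activated once, at a time chosen by an adversary; the activation round is round $0$ of its local clock and it can act from local round $1$ on. In each round an active station either transmits a message (its packet or a one-bit control message) or listens. If exactly one active station transmits, the transmission is successful: the transmitter gets an acknowledgement and all other active stations receive the message; otherwise nothing is received (silence and collision are indistinguishable). The algorithm is adaptive: decisions may depend on the history of received messages, and a station may stay active for some time after its successful transmission. An adaptive adversary decides online which station to activate and when, knowing the algorithm and the history but not future randomness; in total it activates $k$ stations. The stations do not know $k$. Algorithm AdaptiveNoK, run by each station $u$ from its activation. Control messages: "D mode" and "is there anybody out there?" (encoded by one bit each). (1) Waiting loop: $u$ repeatedly listens for 4 rounds, until in some such block it either receives no message or receives the message "is there anybody out there?"; then it leaves the loop and enters leader election mode (L mode). (2) L mode: $u$ executes DecreaseSlowly: for $i=0,1,2,\ldots$, in its $i$-th round of the protocol transmit its packet with probability $q\cdot\frac{1}{2q+i}$, where $q>0$ is a (sufficiently large) constant parameter. At the first successful transmission the successful station becomes the leader, and the leader and all other stations then executing L mode set a common variable time_counter to $0$ (incremented every round) and enter dissemination mode (D mode); let $C$ be the set of these stations other than the leader. (3) D mode. In rounds where time_counter is odd, the stations of $C$ execute one step of the protocol SUniform, each switching off permanently at its first successful transmission.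 In rounds where time_counter $=2^x$ for an integer $x\ge 1$, the leader and all still active stations of $C$ transmit "is there anybody out there?"; if this transmission by the leader is successful, the leader switches off permanently (and D mode ends). In all other even rounds the leader transmits "D mode". SUniform is a Back-on/Back-off (sawtooth) protocol for synchronized stations with unknown contention size: a doubly nested loop in which the outer loop doubles a contention window and, for each value, the inner loop repeatedly reduces the window by a constant fraction until it has size $1$; within each window each participating station transmits in one round chosen uniformly at random. It satisfies the following known guarantee: for any predefined constant $\alpha>0$, on $k$ synchronized stations it lets all stations transmit successfully within $T=O(k)$ rounds with probability at least $1-1/k^{\alpha}$, and, if it terminates within $T$ rounds, it uses $O(\log^2 T)$ transmissions per station.
   Formalization: The question "is there anybody out there?" is sent at time_counter = 2^x for x ≥ 2 rather than x ≥ 1: with x = 1 rounds 1–4 of D mode can be silent, a second leader can arise, and the expectation is infinite for k ≥ 5. A waiting station leaves its loop at once on hearing the question. *)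

theory Defs
  imports "HOL-Probability.Probability"
begin

text \<open>
  Stations are the numbers below k. A round of an execution is determined by the states of the
  stations, the activations chosen by the adversary and one random number per station, drawn
  uniformly from the unit interval; no station needs more than one random choice per round.
\<close>

datatype message = Packet | D_mode | Anybody_out_there


subsection \<open>The sawtooth protocol SUniform\<close>

text \<open>
  The outer loop runs through the windows 2, 4, 8, ...; the inner loop passes from a window of
  size w to one of size (1 - \<beta>) w, rounded down, and ends with a window of size 1. The chosen slot
  is drawn in the first step of a window, so the field \<open>slot\<close> is meaningful only if \<open>pos\<close> is
  positive.
\<close>

datatype sawtooth = Sawtooth (outer: nat) (width: nat) (pos: nat) (slot: nat)

definition saw_init :: sawtooth where
  "saw_init = Sawtooth 2 2 0 0"

definition saw_slot :: "real \<Rightarrow> sawtooth \<Rightarrow> nat" where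
  "saw_slot u s = (if pos s = 0 then nat \<lfloor>u * real (width s)\<rfloor> else slot s)"

definition saw_transmits :: "real \<Rightarrow> sawtooth \<Rightarrow> bool" where
  "saw_transmits u s \<longleftrightarrow> pos s = saw_slot u s"

definition saw_next :: "real \<Rightarrow> real \<Rightarrow> sawtooth \<Rightarrow> sawtooth" where
  "saw_next \<beta> u s =
    (if Suc (pos s) < width s then Sawtooth (outer s) (width s) (Suc (pos s)) (saw_slot u s)
     else if 1 < width s then Sawtooth (outer s) (max 1 (nat \<lfloor>(1 - \<beta>) * real (width s)\<rfloor>)) 0 0
     else Sawtooth (2 * outer s) (2 * outer s) 0 0)"


subsection \<open>The algorithm AdaptiveNoK\<close>

text \<open>
  \<open>Waiting n b\<close>: n rounds of the current block of four have been listened to, and b tells whether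
  a message was received in them. \<open>Electing i\<close>: L mode, the coming round is the i-th one of
  DecreaseSlowly. \<open>Leader t\<close> and \<open>Member t s\<close>: D mode, with value t of time\_counter in the coming
  round; the members are the stations of C that are still active.
\<close>

datatype station =
    Asleep
  | Waiting nat bool
  | Electing nat
  | Leader nat
  | Member nat sawtooth
  | Off

text \<open>
  The exponent starts at 2. If the rounds 2 and 4 of D mode were both used for the question
  ``is there anybody out there?'', there could be four consecutive rounds of D mode, 1 to 4, in which
  nothing is received; stations that are waiting then would enter L mode and could elect a second
  leader in an odd round of the first one. Each of the two leaders would then transmit in all rounds
  in which the members of the other one run SUniform, so that with positive probability the
  execution would never end and the expected number of transmissions would be infinite.
\<close>

definition probe_round :: "nat \<Rightarrow> bool" where
  "probe_round t \<longleftrightarrow> (\<exists>x\<ge>2. t = 2 ^ x)"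

fun action :: "real \<Rightarrow> real \<Rightarrow> station \<Rightarrow> message option" where
  "action q u (Electing i) = (if u < q * (1 / (2 * q + real i)) then Some Packet else None)"
| "action q u (Leader t) =
    (if odd t then None else if probe_round t then Some Anybody_out_there else Some D_mode)"
| "action q u (Member t s) =
    (if odd t then (if saw_transmits u s then Some Packet else None)
     else if probe_round t then Some Anybody_out_there else None)"
| "action q u _ = None"

definition successful :: "(nat \<Rightarrow> message option) \<Rightarrow> nat \<Rightarrow> bool" where
  "successful a i \<longleftrightarrow> {j. a j \<noteq> None} = {i}"

definition received :: "(nat \<Rightarrow> message option) \<Rightarrow> nat \<Rightarrow> message option" where
  "received a i =
    (if \<exists>j. j \<noteq> i \<and> successful a j then a (THE j. successful a j) else None)"

text \<open>
  Here \<open>ack\<close> tells whether the station itself transmitted successfully, and \<open>r\<close> is the message it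
  received, if any. A waiting station leaves the loop in the very round in which it receives the
  question; if it did so only at the end of its block, it could enter L mode when a new D mode has
  already started.
\<close>

fun update :: "real \<Rightarrow> real \<Rightarrow> bool \<Rightarrow> message option \<Rightarrow> station \<Rightarrow> station" where
  "update \<beta> u ack r Asleep = Asleep"
| "update \<beta> u ack r (Waiting n b) =
    (if r = Some Anybody_out_there then Electing 0
     else if Suc n < 4 then Waiting (Suc n) (b \<or> r \<noteq> None)
     else if b \<or> r \<noteq> None then Waiting 0 False
     else Electing 0)"
| "update \<beta> u ack r (Electing i) =
    (if ack then Leader 1 else if r \<noteq> None then Member 1 saw_init else Electing (Suc i))"
| "update \<beta> u ack r (Leader t) = (if ack \<and> probe_round t then Off else Leader (Suc t))"
| "update \<beta> u ack r (Member t s) =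
    (if ack then Off else Member (Suc t) (if odd t then saw_next \<beta> u s else s))"
| "update \<beta> u ack r Off = Off"


subsection \<open>Executions against an adaptive adversary\<close>

text \<open>
  A history lists, latest round first, the actions of all stations in each past round together with
  the states after that round; the adversary sees all of it when it chooses the stations to be
  activated in the coming round.
\<close>

type_synonym history = "((nat \<Rightarrow> message option) \<times> (nat \<Rightarrow> station)) list"

type_synonym adversary = "history \<Rightarrow> nat set"

fun current :: "history \<Rightarrow> nat \<Rightarrow> station" where
  "current [] = (\<lambda>_. Asleep)"
| "current ((a, c) # h) = c"

definition actions :: "real \<Rightarrow> (nat \<Rightarrow> real) \<Rightarrow> history \<Rightarrow> nat \<Rightarrow> message option" where
  "actions q u h i = action q (u i) (current h i)"

definition next_states ::
    "real \<Rightarrow> real \<Rightarrow> nat \<Rightarrow> adversary \<Rightarrow> (nat \<Rightarrow> real) \<Rightarrow> history \<Rightarrow> nat \<Rightarrow> station" where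
  "next_states q \<beta> k adv u h i =
    (if current h i = Asleep \<and> i < k \<and> i \<in> adv h then Waiting 0 False
     else update \<beta> (u i) (successful (actions q u h) i) (received (actions q u h) i)
            (current h i))"

text \<open>\<open>\<omega> (t, i)\<close> is the random number used by station i in round t.\<close>

fun run :: "real \<Rightarrow> real \<Rightarrow> nat \<Rightarrow> adversary \<Rightarrow> (nat \<times> nat \<Rightarrow> real) \<Rightarrow> nat \<Rightarrow> history" where
  "run q \<beta> k adv \<omega> 0 = []"
| "run q \<beta> k adv \<omega> (Suc t) =
    (let h = run q \<beta> k adv \<omega> t; u = (\<lambda>i. \<omega> (t, i))
     in (actions q u h, next_states q \<beta> k adv u h) # h)"

definition coins :: "(nat \<times> nat \<Rightarrow> real) measure" where
  "coins = (\<Pi>\<^sub>M x\<in>UNIV. uniform_measure lborel {0..<1})"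

definition activates_all :: "real \<Rightarrow> real \<Rightarrow> nat \<Rightarrow> adversary \<Rightarrow> bool" where
  "activates_all q \<beta> k adv \<longleftrightarrow> (AE \<omega> in coins. \<forall>i<k. \<exists>t. i \<in> adv (run q \<beta> k adv \<omega> t))"

definition attempts_in_round ::
    "real \<Rightarrow> real \<Rightarrow> nat \<Rightarrow> adversary \<Rightarrow> (nat \<times> nat \<Rightarrow> real) \<Rightarrow> nat \<Rightarrow> nat" where
  "attempts_in_round q \<beta> k adv \<omega> t =
    card {i. i < k \<and> actions q (\<lambda>i. \<omega> (t, i)) (run q \<beta> k adv \<omega> t) i \<noteq> None}"

definition total_attempts ::
    "real \<Rightarrow> real \<Rightarrow> nat \<Rightarrow> adversary \<Rightarrow> (nat \<times> nat \<Rightarrow> real) \<Rightarrow> ennreal" where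
  "total_attempts q \<beta> k adv \<omega> = (\<Sum>t. of_nat (attempts_in_round q \<beta> k adv \<omega> t))"

definition expected_attempts :: "real \<Rightarrow> real \<Rightarrow> nat \<Rightarrow> adversary \<Rightarrow> ennreal" where
  "expected_attempts q \<beta> k adv = (\<integral>\<^sup>+ \<omega>. total_attempts q \<beta> k adv \<omega> \<partial>coins)"

end

theory Submission
  imports Defs
begin

text \<open>
  The proof exhibits a potential of the configuration that bounds the expected number of future
  transmissions, whatever the adversary does.

  L mode: a station pays for its first k rounds from a private budget of order log k. Stations that
  are longer in L mode transmit with total probability at most q. So either the younger stations can
  pay twice, for the older ones as well, or the sum of all probabilities is bounded; in this case the
  round is successful with a probability proportional to its expected cost, and each of the at most
  k successes pays a constant.

  D mode: if n members enter a window of width w, the expected number of those who collide is at most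
  \<open>n\<^sup>2 / w\<close>. Hence n / w, scaled so that a shrinking window is compensated, is a
  supermartingale while it is small, and the inner loop that starts with width W fails with probability
  O(n / W). Once W exceeds a constant multiple of n, the failure probability beats the doubling of the
  windows, so the expected duration is O(n).
\<close>

subsection \<open>Windows of the sawtooth\<close>

text \<open>An adaptive adversary leaves no fixed pattern of activations to average over. The
  potential absorbs this: an \<open>Asleep\<close> station already carries the full price of a
  freshly awakened one, so an activation does not change the value. It then suffices that in every
  round the attempts plus the expected new value are at most the old value; this is iterated over
  finite horizons, so termination is never argued separately. The adversary is an arbitrary
  function. Measurability comes from histories that record only discrete data, hence form a
  countable set. The factor log^2 k has one source: about 2 log k outer windows of size up to k^2,
  each with O(log k) inner windows and one transmission per member and window. This count holds
  surely, without any probability. Beyond k^2, charging k transmissions to every inner window costs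
  only O(W) for outer window W, so the duration bound can carry it. That there is a single leader is
  an invariant, not an event of high probability: during D mode no waiting station can enter L
  mode.\<close>

lemma log2_nat_mono: "1 \<le> (a::nat) \<Longrightarrow> a \<le> b \<Longrightarrow> log 2 (real a) \<le> log 2 (real b)"
  by simp

text \<open>The tangent of \<open>ln\<close> at 2 has slope 1/2 \<le> \<open>ln 2\<close> and a
  nonpositive intercept. In \<open>span_le\<close> this trades a logarithm for a square
  root.\<close>

lemma log2_le_self: "0 < y \<Longrightarrow> log 2 y \<le> y"
proof -
  assume y: "0 < y"
  have "ln y \<le> y / 2 + ln 2 - 1"
    using ln_le_minus_one[of "y / 2"] y by (simp add: ln_div)
  moreover have "ln 2 \<ge> (1/2::real)" using ln2_ge_two_thirds by simp
  moreover have "ln 2 \<le> (1::real)" using ln_le_minus_one[of 2] by simp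
  ultimately have "ln y \<le> y * ln 2"
    using mult_left_mono[of "1/2" "ln 2" y] y by linarith
  then show ?thesis by (simp add: log_def field_simps)
qed

lemma sum_inverse_le: "1 \<le> n \<Longrightarrow> (\<Sum>j\<in>{1..n}. 1 / real j) \<le> 1 + ln (real n)"
proof (induction n rule: nat_induct_at_least)
  case (Suc n)
  have "ln (real n / real (Suc n)) \<le> real n / real (Suc n) - 1"
    using Suc.hyps by (intro ln_le_minus_one) auto
  also have "\<dots> = - (1 / real (Suc n))" by (simp add: field_simps)
  finally have "1 / real (Suc n) \<le> ln (real (Suc n)) - ln (real n)"
    using Suc.hyps by (subst (asm) ln_div) auto
  then show ?case using Suc.IH by simp
qed simp

lemma real_card_filter: "real (card {i. i < (n::nat) \<and> P i}) = (\<Sum>i<n. of_bool (P i))"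
proof -
  have "{i. i < n \<and> P i} = {..<n} \<inter> {i. P i}" by auto
  then show ?thesis by (simp add: sum_of_bool_eq)
qed

section \<open>Width, number and total length of the windows of an inner loop\<close>

locale adaptive =
  fixes q \<beta> :: real and k :: nat and adv :: adversary
  assumes q: "0 < q" and \<beta>: "0 < \<beta>" "\<beta> < 1" and k: "2 \<le> k"
begin

definition shrink :: "nat \<Rightarrow> nat" where
  "shrink w = max 1 (nat \<lfloor>(1 - \<beta>) * real w\<rfloor>)"

text \<open>A bound on the factor by which one shrinking step reduces the width: 1 / (1 - \<beta>)
  for the step itself and 2 for rounding down (\<open>shrink_ratio\<close>).\<close>

definition ratio :: real where "ratio = 2 / (1 - \<beta>)"

text \<open>The fraction is the number of shrinking steps per halving of the width. The extra 1 pays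
  for the last step, to width 1, which may shrink by a smaller factor.\<close>

definition log_slope :: real where "log_slope = 1 + 1 / log 2 (1 / (1 - \<beta>))"

text \<open>Bounds the number of windows of an inner loop that starts with width w.\<close>

definition windows :: "nat \<Rightarrow> real" where
  "windows w = 1 + log_slope * log 2 (real w)"

lemma ratio_ge_2: "2 \<le> ratio"
  using \<beta> by (simp add: ratio_def field_simps)

lemma log_slope_ge_1: "1 \<le> log_slope"
  using \<beta> by (simp add: log_slope_def)

lemma shrink_ge_1: "1 \<le> shrink w"
  by (simp add: shrink_def)

lemma shrink_le: "shrink w \<noteq> 1 \<Longrightarrow> real (shrink w) \<le> (1 - \<beta>) * real w"
proof -
  assume "shrink w \<noteq> 1"
  then have "shrink w = nat \<lfloor>(1 - \<beta>) * real w\<rfloor>" by (auto simp: shrink_def max_def split: if_splits)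
  then show ?thesis using \<beta> by simp
qed

lemma shrink_ratio:
  assumes "1 \<le> w"
  shows "real w \<le> ratio * real (shrink w)"
proof -
  have "(1 - \<beta>) * real w \<le> 2 * real (shrink w)"
  proof (cases "(1 - \<beta>) * real w < 1")
    case True
    then show ?thesis using shrink_ge_1[of w] by linarith
  next
    case False
    then have "1 \<le> \<lfloor>(1 - \<beta>) * real w\<rfloor>" by simp
    then have "(1 - \<beta>) * real w < 2 * real_of_int \<lfloor>(1 - \<beta>) * real w\<rfloor>"
      using real_of_int_floor_add_one_gt[of "(1 - \<beta>) * real w"] by linarith
    moreover have "real_of_int \<lfloor>(1 - \<beta>) * real w\<rfloor> \<le> real (shrink w)"
      by (simp add: shrink_def)
    ultimately show ?thesis by linarith
  qed
  then show ?thesis using \<beta> by (simp add: ratio_def field_simps)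
qed

text \<open>A geometric series: the windows of an inner loop have total length at most 2 / \<beta>
  times the first. The 2 is spent where the shrinking stops at 1, by w \<le> 2 (w - 1).\<close>

lemma shrink_sum:
  assumes "1 < w"
  shows "real w + 2 / \<beta> * real (shrink w) \<le> 2 / \<beta> * real w"
proof (cases "shrink w = 1")
  case True
  have "2 \<le> 2 / \<beta>" using \<beta> by (simp add: field_simps)
  then have "2 * (real w - 1) \<le> 2 / \<beta> * (real w - 1)"
    using assms by (intro mult_right_mono) auto
  then have "2 * (real w - 1) \<le> 2 / \<beta> * real w - 2 / \<beta>" by (simp only: right_diff_distrib mult_1_right)
  then show ?thesis unfolding True using assms by simp
next
  case False
  have "2 / \<beta> * real (shrink w) \<le> 2 / \<beta> * ((1 - \<beta>) * real w)"
    using \<beta> shrink_le[OF False] by (intro mult_left_mono) auto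
  also have "\<dots> = 2 / \<beta> * real w - 2 * real w" using \<beta> by (simp add: field_simps)
  finally show ?thesis by simp
qed

lemma windows_ge_1: "1 \<le> w \<Longrightarrow> 1 \<le> windows w"
  using log_slope_ge_1 by (simp add: windows_def)

lemma windows_mono: "1 \<le> v \<Longrightarrow> v \<le> w \<Longrightarrow> windows v \<le> windows w"
  using log_slope_ge_1 unfolding windows_def by (intro add_left_mono mult_left_mono) auto

lemma windows_shrink:
  assumes "1 < w"
  shows "1 + windows (shrink w) \<le> windows w"
proof (cases "shrink w = 1")
  case True
  have "1 * 1 \<le> log_slope * log 2 (real w)"
    using log_slope_ge_1 assms by (intro mult_mono) auto
  then show ?thesis using True by (simp add: windows_def)
next
  case False
  let ?x = "log 2 (1 / (1 - \<beta>))"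
  have x: "0 < ?x" using \<beta> by simp
  have "log 2 (real (shrink w)) \<le> log 2 ((1 - \<beta>) * real w)"
    using shrink_le[OF False] shrink_ge_1[of w] assms by simp
  also have "\<dots> = log 2 (real w) - ?x"
    using \<beta> assms by (simp add: log_mult log_divide)
  finally have "log_slope * log 2 (real (shrink w)) \<le> log_slope * (log 2 (real w) - ?x)"
    using log_slope_ge_1 by (intro mult_left_mono) auto
  moreover have "log_slope * ?x \<ge> 1" using x by (simp add: log_slope_def field_simps)
  ultimately show ?thesis by (simp add: windows_def algebra_simps)
qed

text \<open>Charge for the transmissions in one window. As long as the outer window is at most the square of k,
  every member pays for its own transmission from its \<open>early\<close> share. Larger outer windows are long
  compared with k times the number of their inner windows.\<close>

definition late :: "nat \<Rightarrow> real" where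
  "late W = (if W \<le> k^2 then 0 else real k)"

definition span :: "nat \<Rightarrow> nat \<Rightarrow> real" where
  "span W w = 2 / \<beta> * real w + late W * windows w"

text \<open>Cost of a whole inner loop per unit of the outer window (\<open>span_le\<close>): 2 /
  \<beta> for its rounds, the remainder for the late charges.\<close>

definition cost_factor :: real where "cost_factor = 2 / \<beta> + 1 + 2 * log_slope"

text \<open>Bounds the expected cost from the start of outer window W with n members.\<close>

definition later :: "nat \<Rightarrow> nat \<Rightarrow> real" where
  "later W n = max (2 * cost_factor * real W) (24 * cost_factor * ratio * real n - cost_factor * real W)"

text \<open>Bounds the probability that some member is left when the inner loop ends.\<close>

definition fail :: "nat \<Rightarrow> nat \<Rightarrow> real" where
  "fail w n = min 1 (ratio * real n / real w)"

text \<open>Value at the start of a window of width \<open>w\<close> within outer window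
  \<open>W\<close>. Later outer windows are charged with the present \<open>n\<close>, not with the
  number left at the end; only a bound on the probability of getting there is tracked.\<close>

definition duration :: "nat \<Rightarrow> nat \<Rightarrow> nat \<Rightarrow> real" where
  "duration W w n = span W w + fail w n * later (2 * W) n"

lemma late_nonneg: "0 \<le> late W"
  by (simp add: late_def)

lemma cost_factor_ge_1: "1 \<le> cost_factor"
  using \<beta> log_slope_ge_1 by (simp add: cost_factor_def)

lemma span_nonneg: "1 \<le> w \<Longrightarrow> 0 \<le> span W w"
  using late_nonneg[of W] windows_ge_1[of w] \<beta> by (simp add: span_def)

lemma span_shrink:
  assumes "1 < w"
  shows "real w + late W + span W (shrink w) \<le> span W w"
  using shrink_sum[OF assms] mult_left_mono[OF windows_shrink[OF assms] late_nonneg[of W]]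
  by (simp add: span_def algebra_simps)

lemma span_1: "1 + late W \<le> span W 1"
  using \<beta> by (simp add: span_def windows_def field_simps)

text \<open>For W > k^2 both k and the number of windows, which is logarithmic in W, are O(sqrt W),
  so their product is O(W). This is why the late charges begin at k^2.\<close>

lemma span_le:
  assumes "1 \<le> W"
  shows "span W W \<le> cost_factor * real W"
proof (cases "W \<le> k^2")
  case True
  then show ?thesis using log_slope_ge_1 assms \<beta>
    by (simp add: span_def late_def cost_factor_def field_simps)
next
  case False
  define s where "s = sqrt (real W)"
  have s: "1 \<le> s" using assms by (simp add: s_def)
  have "real (k^2) \<le> real W" using False by (simp only: of_nat_le_iff)
  then have ks: "real k \<le> s" by (simp add: real_le_rsqrt s_def)
  have "log 2 (real W) = log 2 (s ^ 2)" using assms by (simp add: s_def)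
  also have "\<dots> = 2 * log 2 s" using s by (subst log_nat_power) auto
  also have "\<dots> \<le> 2 * s" using log2_le_self[of s] s by simp
  finally have "log_slope * log 2 (real W) \<le> log_slope * (2 * s)"
    using log_slope_ge_1 by (intro mult_left_mono) auto
  then have "windows W \<le> s * (1 + 2 * log_slope)"
    using s by (simp add: windows_def distrib_left mult.left_commute mult.commute[of s])
  then have "real k * windows W \<le> s * (s * (1 + 2 * log_slope))"
    using ks windows_ge_1[OF assms] by (intro mult_mono) auto
  also have "\<dots> = (1 + 2 * log_slope) * real W"
    by (simp add: s_def flip: mult.assoc)
  finally show ?thesis using False by (simp add: span_def late_def cost_factor_def algebra_simps)
qed

lemma later_nonneg: "0 \<le> later W n"
  using cost_factor_ge_1 by (simp add: later_def le_max_iff_disj)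

lemma later_mono: "n \<le> m \<Longrightarrow> later W n \<le> later W m"
  using cost_factor_ge_1 ratio_ge_2 unfolding later_def
  by (intro max.mono diff_right_mono mult_left_mono) auto

lemma fail_nonneg: "0 \<le> fail w n"
  using ratio_ge_2 by (simp add: fail_def)

lemma fail_mono: "n \<le> m \<Longrightarrow> fail w n \<le> fail w m"
  using ratio_ge_2 unfolding fail_def
  by (intro min.mono divide_right_mono mult_left_mono) auto

lemma fail_le_1: "fail w n \<le> 1"
  by (simp add: fail_def)

lemma duration_mono: "n \<le> m \<Longrightarrow> duration W w n \<le> duration W w m"
  unfolding duration_def
  by (intro add_left_mono mult_mono fail_mono later_mono fail_nonneg later_nonneg)

lemma duration_nonneg: "1 \<le> w \<Longrightarrow> 0 \<le> duration W w n"
  unfolding duration_def using span_nonneg fail_nonneg later_nonneg by simp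

text \<open>Once the outer window exceeds a constant multiple of the contention, the outer loop fails with
  probability at most 1/4 per iteration while the windows only double.\<close>

lemma duration_le_later:
  assumes W: "1 \<le> W"
  shows "duration W W n \<le> later W n"
proof -
  let ?K = "cost_factor" and ?c = ratio
  have K: "1 \<le> ?K" by (rule cost_factor_ge_1)
  show ?thesis
  proof (cases "4 * ?c * real n \<le> real W")
    \<comment> \<open>The two branches of \<open>later (2 * W) n\<close> agree at W = 4 * ratio * n,
      which fixes the coefficient 24. From there on the value is 4 * cost_factor * W, and a quarter
      of it plus the cost of the present loop is the first branch at W.\<close>
    case True
    have "fail W n \<le> 1 / 4"
      using True W by (simp add: fail_def field_simps min_le_iff_disj)
    moreover have "later (2 * W) n \<le> 4 * ?K * real W"
    proof -
      have "6 * ?K * (4 * ?c * real n) \<le> 6 * ?K * real W"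
        using True K by (intro mult_left_mono) auto
      then show ?thesis by (simp add: later_def algebra_simps)
    qed
    ultimately have "fail W n * later (2 * W) n \<le> 1 / 4 * (4 * ?K * real W)"
      by (intro mult_mono later_nonneg) auto
    then have "duration W W n \<le> 2 * ?K * real W"
      using span_le[OF W] by (simp add: duration_def)
    then show ?thesis by (simp add: later_def)
  next
    \<comment> \<open>Here failure is bounded only by 1. The term - cost_factor * W of the second
      branch sums up the windows: doubling W lowers the branch by exactly the bound on
      \<open>span W W\<close>.\<close>
    case False
    then have "6 * ?K * real W \<le> 6 * ?K * (4 * ?c * real n)"
      using K by (intro mult_left_mono) auto
    then have L: "later (2 * W) n = 24 * ?K * ?c * real n - 2 * ?K * real W"
      by (simp add: later_def algebra_simps)
    have "fail W n * later (2 * W) n \<le> 1 * later (2 * W) n"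
      by (intro mult_right_mono fail_le_1 later_nonneg)
    then have "duration W W n \<le> 24 * ?K * ?c * real n - ?K * real W"
      using span_le[OF W] L by (simp add: duration_def)
    then show ?thesis by (simp add: later_def)
  qed
qed

definition rest :: "nat \<Rightarrow> nat \<Rightarrow> nat \<Rightarrow> real" where
  "rest W w n = (if 1 < w then duration W (shrink w) n else duration (2 * W) (2 * W) n)"

lemma rest_mono: "n \<le> m \<Longrightarrow> rest W w n \<le> rest W w m"
  by (simp add: rest_def duration_mono)

lemma rest_nonneg: "1 \<le> W \<Longrightarrow> 0 \<le> rest W w n"
  using duration_nonneg[OF shrink_ge_1] duration_nonneg[of "2 * W"] by (simp add: rest_def)

text \<open>Counts windows, one transmission each: those left in the present inner loop, then log 2
  (k^2) - log 2 W further outer windows with at most \<open>windows (k^2)\<close> each.\<close>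

definition early :: "nat \<Rightarrow> nat \<Rightarrow> real" where
  "early W w = (if W \<le> k^2 then windows w + (log 2 (real (k^2)) - log 2 (real W)) * windows (k^2) else 0)"

definition early_next :: "nat \<Rightarrow> nat \<Rightarrow> real" where
  "early_next W w = (if 1 < w then early W (shrink w) else early (2 * W) (2 * W))"

lemma early_nonneg: "1 \<le> W \<Longrightarrow> 1 \<le> w \<Longrightarrow> 0 \<le> early W w"
proof -
  assume "1 \<le> W" "1 \<le> w"
  moreover have "1 \<le> windows (k^2)" using k by (intro windows_ge_1) simp
  moreover have "1 \<le> windows w" using \<open>1 \<le> w\<close> by (intro windows_ge_1)
  moreover have "log 2 (real W) \<le> log 2 (real (k^2))" if "W \<le> k^2"
    using that \<open>1 \<le> W\<close> by (rule log2_nat_mono[rotated])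
  ultimately show ?thesis by (simp add: early_def)
qed

lemma early_next_nonneg: "1 \<le> W \<Longrightarrow> 0 \<le> early_next W w"
  using early_nonneg[OF _ shrink_ge_1] early_nonneg[of "2 * W" "2 * W"] by (simp add: early_next_def)

text \<open>The drop of the window count pays one transmission per member. Doubling W raises log 2 W
  by 1 and so frees one \<open>windows (k^2)\<close> for the next inner loop; beyond k^2 the shares
  are used up and \<open>late W\<close> = k covers all members.\<close>

lemma early_step:
  assumes W: "1 \<le> W" and w: "1 \<le> w" and n: "n \<le> k"
  shows "real n * (1 + early_next W w) \<le> real n * early W w + late W"
proof (cases "W \<le> k^2")
  case True
  have "1 + early_next W w \<le> early W w"
  proof (cases "1 < w")
    case w: True
    show ?thesis using windows_shrink[OF w] True w by (simp add: early_next_def early_def)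
  next
    case False
    then have [simp]: "w = 1" using w by simp
    show ?thesis
    proof (cases "2 * W \<le> k^2")
      case T: True
      have "windows (2 * W) \<le> windows (k^2)" using T W by (intro windows_mono) auto
      then show ?thesis using True T W
        by (simp add: early_next_def early_def log_mult algebra_simps) (simp add: windows_def)
    next
      case False
      have "0 \<le> early W 1 - 1"
      proof -
        have "1 \<le> windows (k^2)" using k by (intro windows_ge_1) simp
        moreover have "log 2 (real W) \<le> log 2 (real (k^2))"
          using W True by (rule log2_nat_mono)
        ultimately show ?thesis using True by (simp add: early_def windows_def)
      qed
      then show ?thesis using False by (simp add: early_next_def early_def[of "2 * W"])
    qed
  qed
  then have "real n * (1 + early_next W w) \<le> real n * early W w"
    by (intro mult_left_mono) auto
  then show ?thesis using late_nonneg[of W] by linarith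
next
  case False
  then have "early_next W w = 0" by (simp add: early_next_def early_def)
  then show ?thesis using False n by (simp add: late_def early_def)
qed

section \<open>Transmission probabilities of DecreaseSlowly\<close>

definition rate :: "nat \<Rightarrow> real" where
  "rate i = q * (1 / (2 * q + real i))"

lemma rate_nonneg: "0 \<le> rate i"
  using q by (simp add: rate_def)

lemma rate_le_half: "rate i \<le> 1 / 2"
  using q by (simp add: rate_def field_simps)

lemma rate_old: "k \<le> i \<Longrightarrow> rate i \<le> q / real k"
  using q k unfolding rate_def by (simp add: frac_le)

definition young :: "nat \<Rightarrow> real" where
  "young i = 2 * (\<Sum>j\<in>{i..<k}. rate j)"

lemma young_nonneg: "0 \<le> young i"
  unfolding young_def by (intro mult_nonneg_nonneg sum_nonneg rate_nonneg) auto

lemma young_Suc: "young i = (if i < k then 2 * rate i else 0) + young (Suc i)"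
proof (cases "i < k")
  case True
  then have "{i..<k} = insert i {Suc i..<k}" by auto
  then show ?thesis using True by (simp add: young_def algebra_simps)
qed (simp add: young_def)

end

subsection \<open>Gaps and questions in D mode\<close>

text \<open>The length of the run of rounds just before round t of D mode in which possibly no message was
  received. It never reaches the block length 4, which is why no waiting station enters L mode.\<close>

definition gap :: "nat \<Rightarrow> nat" where
  "gap t = (if odd t then if probe_round (t - 1) then 2 else 0
            else if probe_round (t - 2) then 3 else 1)"

lemma probe_dvd_4: "probe_round t \<Longrightarrow> 4 dvd t"
proof -
  assume "probe_round t"
  then obtain x where x: "2 \<le> x" "t = 2 ^ x" by (auto simp: probe_round_def)
  then obtain y where "x = y + 2" using le_Suc_ex[of 2 x] by (auto simp: add.commute)
  then show ?thesis using x by simp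
qed

lemma probe_even: "probe_round t \<Longrightarrow> even t"
  using probe_dvd_4 by (rule dvd_trans[rotated]) auto

lemma probe_ge_4: "probe_round t \<Longrightarrow> 4 \<le> t"
  using probe_dvd_4[of t] by (cases "t = 0") (auto simp: probe_round_def dest: dvd_imp_le)

lemma not_probe_0: "\<not> probe_round 0"
  by (simp add: probe_round_def)

text \<open>Questions are asked in multiples of 4, so no two of them are 2 rounds apart. The longest
  silent run is odd, question, odd, and the even round after it carries
  \<open>D_mode\<close>.\<close>

lemma gap_silent:
  assumes "1 \<le> t" "odd t \<or> probe_round t"
  shows "Suc (gap t) \<le> gap (Suc t)" "Suc (gap t) < 4"
proof -
  have "\<not> probe_round (t - 2)" if "probe_round t"
  proof
    assume "probe_round (t - 2)"
    then have "4 dvd t - 2" "4 dvd t" "4 \<le> t" using that probe_dvd_4 probe_ge_4 by auto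
    then show False by presburger
  qed
  then show "Suc (gap t) \<le> gap (Suc t)" "Suc (gap t) < 4"
    using assms probe_even by (auto simp: gap_def split: if_splits)
qed

text \<open>Savings of 2 per round since the last question. They pay for a question asked in a round
  t > k, in which at most k members take part.\<close>

fun probe_credit :: "nat \<Rightarrow> real" where
  "probe_credit 0 = 0"
| "probe_credit (Suc t) = (if probe_round t then 2 else probe_credit t + 2)"

lemma probe_credit_nonneg: "0 \<le> probe_credit t"
  by (induction t) auto

lemma probe_credit_eq:
  assumes "2 \<le> x" "2 ^ x < t" "t \<le> 2 * 2 ^ x"
  shows "probe_credit t = 2 * (real t - 2 ^ x)"
  using assms(2,3)
proof (induction t)
  case (Suc t)
  show ?case
  proof (cases "t = 2 ^ x")
    case True
    then show ?thesis using assms(1) by (auto simp: probe_round_def)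
  next
    case False
    have "\<not> probe_round t"
    proof
      assume "probe_round t"
      then obtain y where y: "t = 2 ^ y" by (auto simp: probe_round_def)
      have "(2::nat) ^ x \<le> 2 ^ y" using y Suc.prems(1) by linarith
      moreover have "(2::nat) ^ y < 2 ^ Suc x" using y Suc.prems(2) by simp
      moreover have "x \<noteq> y" using y False by auto
      ultimately have "x \<le> y" "y < Suc x" "x \<noteq> y"
        using power_le_imp_le_exp[of "2::nat" x y] power_less_imp_less_exp[of "2::nat" y "Suc x"] by auto
      then show False by simp
    qed
    then show ?thesis using Suc False by simp
  qed
qed simp

text \<open>The preceding question was half of t rounds ago, and each round since then has saved 2.
  The first question, at 4, has no predecessor and is computed directly.\<close>

lemma probe_credit_probe:
  assumes "probe_round t"
  shows "real t \<le> probe_credit t"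
proof -
  obtain x where x: "2 \<le> x" "t = 2 ^ x" using assms by (auto simp: probe_round_def)
  show ?thesis
  proof (cases "x = 2")
    case True
    have "\<not> probe_round j" if "j < 4" for j using probe_ge_4[of j] that by auto
    then have "probe_credit 4 = 8" by (simp add: numeral_eq_Suc)
    then show ?thesis using True x by simp
  next
    case False
    then obtain y where y: "x = Suc y" "2 \<le> y" using x by (cases x) auto
    have "probe_credit t = 2 * (real t - 2 ^ y)" using x y by (intro probe_credit_eq) auto
    then show ?thesis using x y by simp
  qed
qed

text \<open>Rounds up to and including the next question. Once no member is left the leader
  transmits alone, so this is how long it still stays.\<close>

definition tail :: "nat \<Rightarrow> real" where
  "tail t = real (LEAST s. t \<le> s \<and> probe_round s) + 1 - real t"

lemma power_between: "1 \<le> t \<Longrightarrow> \<exists>x. t \<le> 2 ^ x \<and> 2 ^ x < 2 * (t::nat)"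
proof (induction t rule: nat_induct_at_least)
  case base
  then show ?case by (intro exI[of _ 0]) auto
next
  case (Suc t)
  then obtain x where x: "t \<le> 2 ^ x" "2 ^ x < 2 * t" by auto
  then show ?case
    by (cases "t = 2 ^ x") (auto intro: exI[of _ x] exI[of _ "Suc x"])
qed

lemma probe_between:
  assumes "1 \<le> t"
  obtains s where "t \<le> s" "probe_round s" "s \<le> max 4 (2 * t)"
proof -
  obtain x where x: "t \<le> 2 ^ x" "2 ^ x < 2 * t" using power_between assms by blast
  show thesis
  proof (cases "2 \<le> x")
    case True
    then show ?thesis using x by (intro that[of "2 ^ x"]) (auto simp: probe_round_def)
  next
    case False
    then have "(2::nat) ^ x \<le> 2 ^ 1" by (intro power_increasing) auto
    then show ?thesis using x
      by (intro that[of 4]) (auto simp: probe_round_def intro!: exI[of _ 2])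
  qed
qed

lemma tail_le: "1 \<le> t \<Longrightarrow> tail t \<le> real t + 4"
proof -
  assume t: "1 \<le> t"
  then obtain s where s: "t \<le> s" "probe_round s" "s \<le> max 4 (2 * t)" by (rule probe_between)
  then have "(LEAST s. t \<le> s \<and> probe_round s) \<le> s" by (intro Least_le) auto
  then show ?thesis using s t by (simp add: tail_def)
qed

lemma tail_ge_1: "1 \<le> t \<Longrightarrow> 1 \<le> tail t"
proof -
  assume t: "1 \<le> t"
  then obtain s where s: "t \<le> s" "probe_round s" by (rule probe_between)
  then have "t \<le> (LEAST s. t \<le> s \<and> probe_round s)" by (metis (mono_tags, lifting) LeastI)
  then show ?thesis by (simp add: tail_def)
qed

lemma tail_Suc: "\<not> probe_round t \<Longrightarrow> tail t = 1 + tail (Suc t)"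
proof -
  assume "\<not> probe_round t"
  then have "(\<lambda>s. t \<le> s \<and> probe_round s) = (\<lambda>s. Suc t \<le> s \<and> probe_round s)"
    by (metis Suc_leD Suc_leI le_neq_implies_less)
  then show ?thesis by (simp add: tail_def)
qed

text \<open>Questions up to round k are charged to every member separately, at most log 2 k of them;
  the later ones are paid by \<open>probe_credit\<close>.\<close>

definition probes :: "nat \<Rightarrow> nat \<Rightarrow> nat" where
  "probes k t = card {s \<in> {t..k}. probe_round s}"

lemma probes_Suc: "probes k t = (if probe_round t \<and> t \<le> k then 1 else 0) + probes k (Suc t)"
proof (cases "probe_round t \<and> t \<le> k")
  case True
  then have "{s \<in> {t..k}. probe_round s} = insert t {s \<in> {Suc t..k}. probe_round s}" by auto
  then show ?thesis using True by (simp add: probes_def)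
next
  case False
  then have "{s \<in> {t..k}. probe_round s} = {s \<in> {Suc t..k}. probe_round s}"
    by (auto simp: Suc_le_eq order.order_iff_strict)
  then show ?thesis using False by (simp add: probes_def)
qed

lemma probes_le:
  assumes "1 \<le> k"
  shows "real (probes k t) \<le> log 2 (real k)"
proof -
  let ?m = "nat \<lfloor>log 2 (real k)\<rfloor>"
  have "{s \<in> {t..k}. probe_round s} \<subseteq> (\<lambda>x. 2 ^ x) ` {1..?m}"
  proof
    fix s assume s: "s \<in> {s \<in> {t..k}. probe_round s}"
    then obtain x where x: "2 \<le> x" "s = 2 ^ x" by (auto simp: probe_round_def)
    have "2 ^ x \<le> real k" using s x by (metis (mono_tags, lifting) mem_Collect_eq atLeastAtMost_iff of_nat_le_iff of_nat_numeral of_nat_power)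
    then have "real x \<le> log 2 (real k)" using assms by (simp add: le_log_iff powr_realpow)
    then show "s \<in> (\<lambda>x. 2 ^ x) ` {1..?m}" using x by (auto simp: le_nat_floor)
  qed
  then have "probes k t \<le> card ((\<lambda>x. 2 ^ x :: nat) ` {1..?m})"
    unfolding probes_def by (intro card_mono) auto
  also have "\<dots> \<le> ?m" using card_image_le[of "{1..?m}"] by simp
  finally show ?thesis using assms zero_le_log_cancel_iff[of 2 "real k"] by linarith
qed

subsection \<open>Random numbers and histories\<close>

instance message :: countable by countable_datatype
instance sawtooth :: countable by countable_datatype
instance station :: countable by countable_datatype

definition unit_uniform :: "real measure" where
  "unit_uniform = uniform_measure lborel {0..<1}"

definition round_coins :: "(nat \<Rightarrow> real) measure" where
  "round_coins = (\<Pi>\<^sub>M i\<in>UNIV. unit_uniform)"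

lemma sets_unit_uniform [measurable_cong, simp]: "sets unit_uniform = sets borel"
  by (simp add: unit_uniform_def)

lemma space_unit_uniform [simp]: "space unit_uniform = UNIV"
  by (simp add: unit_uniform_def)

lemma prob_space_unit_uniform: "prob_space unit_uniform"
  unfolding unit_uniform_def by (rule prob_space_uniform_measure) auto

lemma coins_eq: "coins = (\<Pi>\<^sub>M x\<in>UNIV. unit_uniform)"
  by (simp add: coins_def unit_uniform_def)

lemma prob_space_coins: "prob_space coins"
  unfolding coins_eq by (intro prob_space_PiM prob_space_unit_uniform)

lemma prob_space_round_coins: "prob_space round_coins"
  unfolding round_coins_def by (intro prob_space_PiM prob_space_unit_uniform)

interpretation unit_uniform: prob_space unit_uniform by (rule prob_space_unit_uniform)
interpretation round_coins: prob_space round_coins by (rule prob_space_round_coins)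

lemma space_round_coins [simp]: "space round_coins = UNIV"
  by (simp add: round_coins_def space_PiM)

lemma space_coins [simp]: "space coins = UNIV"
  by (simp add: coins_eq space_PiM)

lemma measurable_round_coin [measurable]: "(\<lambda>u. u i) \<in> borel_measurable round_coins"
  unfolding round_coins_def by measurable

lemma integrable_round_indicator:
  "A \<in> sets round_coins \<Longrightarrow> integrable round_coins (\<lambda>u. indicator A u :: real)"
  by (rule integrable_real_indicator) (simp_all add: round_coins.emeasure_eq_measure)

lemma prob_round_coins_UNIV [simp]: "round_coins.prob UNIV = 1"
  using round_coins.prob_space by simp

lemma prob_unit_uniform:
  "A \<in> sets borel \<Longrightarrow> measure unit_uniform A = measure lborel ({0..<1} \<inter> A)"
  unfolding unit_uniform_def by (subst measure_uniform_measure) auto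

lemma prob_unit_less: "0 \<le> p \<Longrightarrow> p \<le> 1 \<Longrightarrow> unit_uniform.prob {..<p} = p"
proof -
  assume "0 \<le> p" "p \<le> 1"
  moreover have "{0..<1} \<inter> {..<p} = {0..<p}" using \<open>p \<le> 1\<close> by auto
  ultimately show ?thesis by (simp add: prob_unit_uniform)
qed

lemma prob_unit_ge: "0 \<le> p \<Longrightarrow> p \<le> 1 \<Longrightarrow> unit_uniform.prob {p..} = 1 - p"
proof -
  assume "0 \<le> p" "p \<le> 1"
  moreover have "{0..<1} \<inter> {p..} = {p..<1}" using \<open>0 \<le> p\<close> by auto
  ultimately show ?thesis by (simp add: prob_unit_uniform)
qed

section \<open>Collisions and unique transmitters among independent uniform numbers\<close>

lemma prob_round_coins:
  assumes "finite J" "\<And>i. i \<in> J \<Longrightarrow> X i \<in> sets borel"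
  shows "round_coins.prob {u. \<forall>i\<in>J. u i \<in> X i} = (\<Prod>i\<in>J. unit_uniform.prob (X i))"
proof -
  interpret P: product_prob_space "\<lambda>_. unit_uniform" "UNIV :: nat set" by unfold_locales
  have "emeasure round_coins {u. \<forall>i\<in>J. u i \<in> X i} = (\<Prod>i\<in>J. emeasure unit_uniform (X i))"
    using P.emeasure_PiM_Collect[of J X] assms by (simp add: round_coins_def space_PiM)
  then show ?thesis
    by (simp add: round_coins.emeasure_eq_measure unit_uniform.emeasure_eq_measure prod_ennreal prod_nonneg)
qed

lemma slot_set: "{x. nat \<lfloor>x * real w\<rfloor> = s} \<in> sets borel"
  by measurable

lemma prob_slot:
  assumes "s < w"
  shows "unit_uniform.prob {x. nat \<lfloor>x * real w\<rfloor> = s} = 1 / real w"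
proof -
  have w: "0 < real w" using assms by simp
  have "{0..<1} \<inter> {x. nat \<lfloor>x * real w\<rfloor> = s} = {real s / real w..<(real s + 1) / real w}"
  proof (intro set_eqI iffI)
    fix x assume "x \<in> {0..<1} \<inter> {x. nat \<lfloor>x * real w\<rfloor> = s}"
    then have "0 \<le> x" "nat \<lfloor>x * real w\<rfloor> = s" by auto
    then have "\<lfloor>x * real w\<rfloor> = int s" using w by auto
    then have "real s \<le> x * real w" "x * real w < real s + 1" by linarith+
    then show "x \<in> {real s / real w..<(real s + 1) / real w}" using w by (auto simp: field_simps)
  next
    fix x assume "x \<in> {real s / real w..<(real s + 1) / real w}"
    then have x: "real s \<le> x * real w" "x * real w < real s + 1" using w by (auto simp: field_simps)
    then have "\<lfloor>x * real w\<rfloor> = int s" by linarith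
    moreover have "0 \<le> x" using x(1) w by (metis of_nat_0_le_iff order_trans zero_le_mult_iff not_less)
    moreover have "x * real w < 1 * real w" using x(2) assms by linarith
    then have "x < 1" using w by simp
    ultimately show "x \<in> {0..<1} \<inter> {x. nat \<lfloor>x * real w\<rfloor> = s}" by auto
  qed
  then show ?thesis using w by (simp add: prob_unit_uniform slot_set field_simps)
qed

lemma prob_slot_overflow:
  assumes "0 < w"
  shows "unit_uniform.prob {x. w \<le> nat \<lfloor>x * real w\<rfloor>} = 0"
proof -
  have "\<not> w \<le> nat \<lfloor>x * real w\<rfloor>" if "0 \<le> x" "x < 1" for x
  proof -
    have "x * real w < 1 * real w" using that assms by (intro mult_strict_right_mono) auto
    then have "\<lfloor>x * real w\<rfloor> < int w" by (simp add: floor_less_iff)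
    then show ?thesis using that by (simp add: not_le nat_less_iff)
  qed
  then have "{0..<1} \<inter> {x. w \<le> nat \<lfloor>x * real w\<rfloor>} = {}" by auto
  then show ?thesis by (subst prob_unit_uniform) auto
qed

lemma prob_overflow:
  assumes "0 < w"
  shows "round_coins.prob {u. w \<le> nat \<lfloor>u i * real w\<rfloor>} = 0"
  using prob_round_coins[of "{i}" "\<lambda>_. {x. w \<le> nat \<lfloor>x * real w\<rfloor>}"] prob_slot_overflow[OF assms]
  by simp

text \<open>A union bound over the w common slots. Overflow has probability 0 but is carried along
  because the random numbers range over all reals; negative ones land in slot 0 through
  \<open>nat\<close>.\<close>

lemma prob_collision:
  assumes "0 < w" "i \<noteq> j"
  shows "round_coins.prob {u. nat \<lfloor>u i * real w\<rfloor> = nat \<lfloor>u j * real w\<rfloor>} \<le> 1 / real w"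
proof -
  let ?O = "{u. w \<le> nat \<lfloor>u i * real w\<rfloor>}"
  let ?S = "\<lambda>s. {u. \<forall>l\<in>{i, j}. u l \<in> {x. nat \<lfloor>x * real w\<rfloor> = s}}"
  have "{u \<in> space round_coins. w \<le> nat \<lfloor>u i * real w\<rfloor>} \<in> sets round_coins" by measurable
  then have O: "?O \<in> sets round_coins" by simp
  have "{u \<in> space round_coins. nat \<lfloor>u i * real w\<rfloor> = s \<and> nat \<lfloor>u j * real w\<rfloor> = s} \<in> sets round_coins" for s
    by measurable
  then have S: "?S s \<in> sets round_coins" for s by simp
  have "{u. nat \<lfloor>u i * real w\<rfloor> = nat \<lfloor>u j * real w\<rfloor>} \<subseteq> ?O \<union> (\<Union>s\<in>{..<w}. ?S s)"
    by (auto simp: not_le)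
  then have "round_coins.prob {u. nat \<lfloor>u i * real w\<rfloor> = nat \<lfloor>u j * real w\<rfloor>}
      \<le> round_coins.prob (?O \<union> (\<Union>s\<in>{..<w}. ?S s))"
    using O S by (intro round_coins.finite_measure_mono) auto
  also have "\<dots> \<le> round_coins.prob ?O + round_coins.prob (\<Union>s\<in>{..<w}. ?S s)"
    using O S by (intro measure_Un_le) auto
  also have "\<dots> \<le> round_coins.prob ?O + (\<Sum>s\<in>{..<w}. round_coins.prob (?S s))"
    using S by (intro add_left_mono round_coins.finite_measure_subadditive_finite) auto
  also have "\<dots> = (\<Sum>s\<in>{..<w}. 1 / real w * (1 / real w))"
    using prob_overflow[OF assms(1)] assms(2) prob_slot
    by (subst prob_round_coins) (auto simp: slot_set intro!: sum.cong)
  also have "\<dots> = 1 / real w" using assms by simp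
  finally show ?thesis .
qed

text \<open>\<open>X\<close> counts overflows and ordered pairs in a common slot, so it dominates
  the number of stations that are not alone in a proper slot
  (\<open>survivors_le_collisions\<close>).\<close>

lemma expected_collisions:
  assumes A: "finite A" and w: "0 < w"
  defines "X \<equiv> \<lambda>u. \<Sum>i\<in>A. of_bool (w \<le> nat \<lfloor>u i * real w\<rfloor>) +
    (\<Sum>j\<in>A - {i}. of_bool (nat \<lfloor>u i * real w\<rfloor> = nat \<lfloor>u j * real w\<rfloor>)) :: real"
  shows "integrable round_coins X" "integral\<^sup>L round_coins X \<le> real (card A) ^ 2 / real w"
proof -
  let ?O = "\<lambda>i. {u. w \<le> nat \<lfloor>u i * real w\<rfloor>}"
  let ?C = "\<lambda>i j. {u. nat \<lfloor>u i * real w\<rfloor> = nat \<lfloor>u j * real w\<rfloor>}"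
  have X: "X = (\<lambda>u. \<Sum>i\<in>A. indicator (?O i) u + (\<Sum>j\<in>A - {i}. indicator (?C i j) u))"
    by (simp add: X_def indicator_def)
  have sets: "?O i \<in> sets round_coins" "?C i j \<in> sets round_coins" for i j
  proof -
    have "{u \<in> space round_coins. w \<le> nat \<lfloor>u i * real w\<rfloor>} \<in> sets round_coins" by measurable
    then show "?O i \<in> sets round_coins" by simp
    have "{u \<in> space round_coins. nat \<lfloor>u i * real w\<rfloor> = nat \<lfloor>u j * real w\<rfloor>} \<in> sets round_coins" by measurable
    then show "?C i j \<in> sets round_coins" by simp
  qed
  show "integrable round_coins X"
    unfolding X by (intro Bochner_Integration.integrable_add Bochner_Integration.integrable_sum integrable_round_indicator sets)
  have "integral\<^sup>L round_coins X = (\<Sum>i\<in>A. integral\<^sup>L round_coins (\<lambda>u. indicator (?O i) u + (\<Sum>j\<in>A - {i}. indicator (?C i j) u)))"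
    unfolding X by (intro Bochner_Integration.integral_sum Bochner_Integration.integrable_add Bochner_Integration.integrable_sum integrable_round_indicator sets)
  also have "\<dots> = (\<Sum>i\<in>A. round_coins.prob (?O i) + (\<Sum>j\<in>A - {i}. round_coins.prob (?C i j)))"
  proof (rule sum.cong[OF refl])
    fix i
    have "integral\<^sup>L round_coins (\<lambda>u. indicator (?O i) u + (\<Sum>j\<in>A - {i}. indicator (?C i j) u)) =
        integral\<^sup>L round_coins (\<lambda>u. indicator (?O i) u :: real) +
        integral\<^sup>L round_coins (\<lambda>u. \<Sum>j\<in>A - {i}. indicator (?C i j) u)"
      by (intro Bochner_Integration.integral_add Bochner_Integration.integrable_sum integrable_round_indicator sets)
    also have "integral\<^sup>L round_coins (\<lambda>u. \<Sum>j\<in>A - {i}. indicator (?C i j) u :: real) =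
        (\<Sum>j\<in>A - {i}. integral\<^sup>L round_coins (\<lambda>u. indicator (?C i j) u))"
      by (intro Bochner_Integration.integral_sum integrable_round_indicator sets)
    finally show "integral\<^sup>L round_coins (\<lambda>u. indicator (?O i) u + (\<Sum>j\<in>A - {i}. indicator (?C i j) u)) =
        round_coins.prob (?O i) + (\<Sum>j\<in>A - {i}. round_coins.prob (?C i j))"
      by simp
  qed
  also have "\<dots> \<le> (\<Sum>i\<in>A. 0 + (\<Sum>j\<in>A - {i}. 1 / real w))"
    using prob_overflow[OF w] prob_collision[OF w] by (intro sum_mono add_mono) auto
  also have "\<dots> \<le> (\<Sum>i\<in>A. real (card A) * (1 / real w))"
    using A by (intro sum_mono) (auto intro!: divide_right_mono card_Diff1_le)
  also have "\<dots> = real (card A) ^ 2 / real w" by (simp add: power2_eq_square)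
  finally show "integral\<^sup>L round_coins X \<le> real (card A) ^ 2 / real w" .
qed

text \<open>The convex function 4 powr (- x) agrees with 1 - x at 0 and at 1/2, so it lies below
  this chord in between. The base 4 fits rates of at most 1/2 (\<open>rate_le_half\<close>).\<close>

lemma powr_4_le:
  assumes "0 \<le> x" "x \<le> 1 / 2"
  shows "4 powr (- x) \<le> (1 - x :: real)"
proof -
  have "exp ((1 - 2 * x) *\<^sub>R 0 + (2 * x) *\<^sub>R (- ln 2)) \<le> (1 - 2 * x) * exp 0 + 2 * x * exp (- ln (2::real))"
    using assms by (intro convex_onD[OF exp_convex]) auto
  moreover have "4 powr (- x) = exp (2 * x * (- ln 2))"
    using ln_realpow[of 2 2] by (simp add: powr_def)
  ultimately show ?thesis by (simp add: exp_minus)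
qed

text \<open>The events that i alone transmits are disjoint, with probability p i times the product
  of 1 - p j over the others; \<open>powr_4_le\<close> turns the product into a power of the
  sum.\<close>

lemma prob_unique_success:
  assumes I: "finite I" and p: "\<And>i. i \<in> I \<Longrightarrow> 0 \<le> p i \<and> p i \<le> 1 / 2"
  shows "(\<Sum>i\<in>I. p i) * 4 powr (- (\<Sum>i\<in>I. p i)) \<le> round_coins.prob {u. \<exists>!i. i \<in> I \<and> u i < p i}"
proof -
  let ?X = "\<lambda>i j. if j = i then {..<p j} else {p j..}"
  let ?S = "\<lambda>i. {u. \<forall>j\<in>I. u j \<in> ?X i j}"
  have S: "?S i \<in> sets round_coins" for i
  proof -
    have "?S i = {u \<in> space round_coins. \<forall>j\<in>I. (j = i \<longrightarrow> u j < p j) \<and> (j \<noteq> i \<longrightarrow> p j \<le> u j)}"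
      by (auto split: if_splits)
    also have "\<dots> \<in> sets round_coins" using I by measurable
    finally show ?thesis .
  qed
  have "p i * 4 powr (- (\<Sum>i\<in>I. p i)) \<le> round_coins.prob (?S i)" if i: "i \<in> I" for i
  proof -
    have "p i * 4 powr (- (\<Sum>i\<in>I. p i)) = p i * (\<Prod>j\<in>I. 4 powr (- p j))"
      using I by (simp add: powr_sum flip: sum_negf)
    also have "\<dots> \<le> p i * (\<Prod>j\<in>I - {i}. 1 - p j)"
    proof (intro mult_left_mono)
      have "(\<Prod>j\<in>I. 4 powr (- p j)) = 4 powr (- p i) * (\<Prod>j\<in>I - {i}. 4 powr (- p j))"
        using I i by (rule prod.remove)
      also have "\<dots> \<le> 1 * (\<Prod>j\<in>I - {i}. 1 - p j)"
        using p i powr_4_le[of "p i"] by (intro mult_mono prod_mono prod_nonneg) (force intro: powr_4_le)+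
      finally show "(\<Prod>j\<in>I. 4 powr (- p j)) \<le> (\<Prod>j\<in>I - {i}. 1 - p j)" by simp
    qed (use p i in auto)
    also have "\<dots> = (\<Prod>j\<in>I. unit_uniform.prob (?X i j))"
    proof (subst prod.remove[OF I i], intro arg_cong2[where f = times] prod.cong)
      show "p i = unit_uniform.prob (?X i i)" using p[OF i] prob_unit_less[of "p i"] by simp
    next
      fix j assume "j \<in> I - {i}"
      then show "1 - p j = unit_uniform.prob (?X i j)" using p[of j] prob_unit_ge[of "p j"] by simp
    qed simp
    also have "\<dots> = round_coins.prob (?S i)" using I by (subst prob_round_coins) auto
    finally show ?thesis .
  qed
  then have "(\<Sum>i\<in>I. p i) * 4 powr (- (\<Sum>i\<in>I. p i)) \<le> (\<Sum>i\<in>I. round_coins.prob (?S i))"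
    by (simp add: sum_distrib_right sum_mono)
  also have "\<dots> = round_coins.prob (\<Union>i\<in>I. ?S i)"
  proof (rule round_coins.finite_measure_finite_Union[symmetric, OF I])
    show "disjoint_family_on ?S I"
      unfolding disjoint_family_on_def by (fastforce split: if_splits)
  qed (use S in blast)
  also have "(\<Union>i\<in>I. ?S i) = {u. \<exists>!i. i \<in> I \<and> u i < p i}"
  proof -
    have "u \<in> ?S i \<longleftrightarrow> (\<forall>j\<in>I. u j < p j \<longleftrightarrow> j = i)" for u i
      unfolding mem_Collect_eq by (rule ball_cong[OF refl]) (simp add: not_less)
    then have "u \<in> (\<Union>i\<in>I. ?S i) \<longleftrightarrow> (\<exists>i\<in>I. \<forall>j\<in>I. u j < p j \<longleftrightarrow> j = i)" for u
      by (simp only: UN_iff)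
    moreover have "(\<exists>i\<in>I. \<forall>j\<in>I. u j < p j \<longleftrightarrow> j = i) \<longleftrightarrow> (\<exists>!i. i \<in> I \<and> u i < p i)" for u
      by metis
    ultimately have "u \<in> (\<Union>i\<in>I. ?S i) \<longleftrightarrow> u \<in> {u. \<exists>!i. i \<in> I \<and> u i < p i}" for u
      by (simp only: mem_Collect_eq)
    then show ?thesis by (rule set_eqI)
  qed
  finally show ?thesis .
qed

text \<open>The majorant is real because the one for L mode contains a subtracted term, while
  subtraction in \<open>ennreal\<close> is truncated.\<close>

lemma nn_integral_le_ennreal:
  assumes "integrable M f" "\<And>x. x \<in> space M \<Longrightarrow> g x \<le> ennreal (f x)" "\<And>x. x \<in> space M \<Longrightarrow> 0 \<le> f x"
    "integral\<^sup>L M f \<le> v"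
  shows "(\<integral>\<^sup>+x. g x \<partial>M) \<le> ennreal v"
proof -
  have "(\<integral>\<^sup>+x. g x \<partial>M) \<le> (\<integral>\<^sup>+x. ennreal (f x) \<partial>M)" by (intro nn_integral_mono assms)
  also have "\<dots> = ennreal (integral\<^sup>L M f)"
    using assms by (intro nn_integral_eq_integral) auto
  finally show ?thesis using assms(4) by (meson ennreal_leI order_trans)
qed

section \<open>Histories: countability, measurability, independence of the coming round\<close>

definition history_step ::
    "real \<Rightarrow> real \<Rightarrow> nat \<Rightarrow> adversary \<Rightarrow> history \<Rightarrow> (nat \<Rightarrow> real) \<Rightarrow> history" where
  "history_step q \<beta> k adv h u = (actions q u h, next_states q \<beta> k adv u h) # h"

lemma run_Suc: "run q \<beta> k adv \<omega> (Suc t) = history_step q \<beta> k adv (run q \<beta> k adv \<omega> t) (\<lambda>i. \<omega> (t, i))"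
  by (simp add: history_step_def Let_def)

definition histories :: "nat \<Rightarrow> history set" where
  "histories k = lists ({a. \<forall>i\<ge>k. a i = None} \<times> {c. \<forall>i\<ge>k. c i = Asleep})"

lemma countable_eventually_constant:
  "countable {f :: nat \<Rightarrow> 'a :: countable. \<forall>i\<ge>k. f i = d}"
proof -
  have "f \<in> (\<lambda>g i. if i < k then g i else d) ` (\<Pi>\<^sub>E i\<in>{..<k}. UNIV)"
    if "\<forall>i\<ge>k. f i = d" for f :: "nat \<Rightarrow> 'a"
    using that by (intro image_eqI[of _ _ "restrict f {..<k}"]) (auto simp: fun_eq_iff)
  then have "{f :: nat \<Rightarrow> 'a. \<forall>i\<ge>k. f i = d} \<subseteq> (\<lambda>g i. if i < k then g i else d) ` (\<Pi>\<^sub>E i\<in>{..<k}. UNIV)"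
    by blast
  moreover have "countable ((\<lambda>g i. if i < k then g i else d) ` (\<Pi>\<^sub>E i\<in>{..<k}. (UNIV :: 'a set)))"
    by (intro countable_image countable_PiE) auto
  ultimately show ?thesis by (rule countable_subset)
qed

text \<open>States and messages are countable types and only k stations ever leave
  \<open>Asleep\<close>. Hence on the discrete space of histories every function, and with it every
  adversary, is measurable.\<close>

lemma countable_histories: "countable (histories k)"
  unfolding histories_def by (intro countable_lists countable_SIGMA countable_eventually_constant)

lemma current_histories: "h \<in> histories k \<Longrightarrow> k \<le> i \<Longrightarrow> current h i = Asleep"
  by (cases h rule: current.cases) (auto simp: histories_def)

lemma history_step_histories: "h \<in> histories k \<Longrightarrow> history_step q \<beta> k adv h u \<in> histories k"
  using current_histories[of h k]
  by (auto simp: history_step_def histories_def actions_def next_states_def)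

lemma run_histories: "run q \<beta> k adv \<omega> t \<in> histories k"
proof (induction t)
  case (Suc t)
  then show ?case unfolding run_Suc by (rule history_step_histories)
qed (simp add: histories_def)

lemma pred_action [measurable]:
  "Measurable.pred borel (\<lambda>x. action q x s = a)"
proof (cases s)
  case (Member t s')
  show ?thesis unfolding Member by (cases "odd t"; cases "probe_round t") (simp_all add: saw_transmits_def saw_slot_def if_distrib)
qed simp_all

lemma pred_saw_slot [measurable]: "Measurable.pred borel (\<lambda>x. saw_slot x s = m)"
  by (simp add: saw_slot_def)

lemma pred_saw_next [measurable]: "Measurable.pred borel (\<lambda>x. saw_next \<beta> x s = s')"
proof -
  \<comment> \<open>The random number matters only through the drawn slot, and only if the window
    goes on; otherwise 0 stands in for it.\<close>
  have "Measurable.pred borel (\<lambda>x. (if Suc (pos s) < width s then s' = Sawtooth (outer s) (width s) (Suc (pos s)) (slot s') \<and> saw_slot x s = slot s'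
     else saw_next \<beta> 0 s = s'))"
    by measurable
  moreover have "(\<lambda>x. (if Suc (pos s) < width s then s' = Sawtooth (outer s) (width s) (Suc (pos s)) (slot s') \<and> saw_slot x s = slot s'
     else saw_next \<beta> 0 s = s')) = (\<lambda>x. saw_next \<beta> x s = s')"
    by (cases s') (auto simp: saw_next_def fun_eq_iff)
  ultimately show ?thesis by simp
qed

lemma pred_update [measurable]: "Measurable.pred borel (\<lambda>x. update \<beta> x ack r s = s')"
proof (cases s)
  case (Member t z)
  have "(\<lambda>x. update \<beta> x ack r s = s') = (\<lambda>x. if ack \<or> even t then update \<beta> 0 ack r s = s'
      else (\<exists>z'. s' = Member (Suc t) z' \<and> saw_next \<beta> x z = z'))"
    by (auto simp: Member fun_eq_iff)
  then show ?thesis by simp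
qed simp_all

lemma measurable_history_step:
  assumes h: "h \<in> histories k"
  shows "history_step q \<beta> k adv h \<in> measurable round_coins (count_space (histories k))"
  unfolding measurable_count_space_eq_countable[OF countable_histories]
proof (intro conjI ballI)
  show "history_step q \<beta> k adv h \<in> space round_coins \<rightarrow> histories k"
    using history_step_histories[OF h] by auto
next
  fix h' assume "h' \<in> histories k"
  show "history_step q \<beta> k adv h -` {h'} \<inter> space round_coins \<in> sets round_coins"
  proof (cases "\<exists>a c. h' = (a, c) # h")
    case False
    then have "history_step q \<beta> k adv h -` {h'} = {}" by (auto simp: history_step_def)
    then show ?thesis by simp
  next
    case True
    then obtain a c where h': "h' = (a, c) # h" by auto
    have A: "Measurable.pred round_coins (\<lambda>u. action q (u i) (current h i) = a i)" for i
      by (rule measurable_compose[OF measurable_round_coin pred_action])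
    have U: "Measurable.pred round_coins (\<lambda>u. update \<beta> (u i) x r (current h i) = c i)" for i x r
      by (rule measurable_compose[OF measurable_round_coin pred_update])
    \<comment> \<open>With the target actions \<open>a\<close> fixed, \<open>successful\<close> and
      \<open>received\<close> are constants, so the preimage is a countable conjunction of
      conditions on single coordinates.\<close>
    have "history_step q \<beta> k adv h -` {h'} \<inter> space round_coins =
      {u \<in> space round_coins. (\<forall>i. action q (u i) (current h i) = a i) \<and>
         (\<forall>i. (current h i = Asleep \<and> i < k \<and> i \<in> adv h \<and> Waiting 0 False = c i) \<or>
            (\<not> (current h i = Asleep \<and> i < k \<and> i \<in> adv h) \<and>
             update \<beta> (u i) (successful a i) (received a i) (current h i) = c i))}"
    proof -
      have "history_step q \<beta> k adv h u = h' \<longleftrightarrow>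
          (\<forall>i. action q (u i) (current h i) = a i) \<and>
          (\<forall>i. (current h i = Asleep \<and> i < k \<and> i \<in> adv h \<and> Waiting 0 False = c i) \<or>
            (\<not> (current h i = Asleep \<and> i < k \<and> i \<in> adv h) \<and>
             update \<beta> (u i) (successful a i) (received a i) (current h i) = c i))" for u
      proof -
        have "history_step q \<beta> k adv h u = h' \<longleftrightarrow>
            actions q u h = a \<and> (\<forall>i. next_states q \<beta> k adv u h i = c i)"
          by (simp add: history_step_def h' fun_eq_iff)
        also have "\<dots> \<longleftrightarrow> actions q u h = a \<and>
          (\<forall>i. (current h i = Asleep \<and> i < k \<and> i \<in> adv h \<and> Waiting 0 False = c i) \<or>
            (\<not> (current h i = Asleep \<and> i < k \<and> i \<in> adv h) \<and>
             update \<beta> (u i) (successful a i) (received a i) (current h i) = c i))"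
          by (intro conj_cong refl all_cong1) (auto simp: next_states_def)
        also have "actions q u h = a \<longleftrightarrow> (\<forall>i. action q (u i) (current h i) = a i)"
          by (simp add: actions_def fun_eq_iff)
        finally show ?thesis .
      qed
      then show ?thesis by auto
    qed
    also have "\<dots> \<in> sets round_coins"
      unfolding pred_def[symmetric]
      by (intro pred_intros_logic pred_intros_countable A U measurable_const) simp_all
    finally show ?thesis .
  qed
qed

lemma run_cong:
  "(\<And>s i. s < t \<Longrightarrow> \<omega> (s, i) = \<omega>' (s, i)) \<Longrightarrow> run q \<beta> k adv \<omega> t = run q \<beta> k adv \<omega>' t"
  by (induction t) auto

text \<open>The index set is general because independence needs the history as a function of the
  past coordinates alone, whereas the expectations need it on all of \<open>coins\<close>.\<close>

lemma measurable_run: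
  assumes "{..<t} \<times> UNIV \<subseteq> A"
  shows "(\<lambda>\<omega>. run q \<beta> k adv \<omega> t) \<in> measurable (\<Pi>\<^sub>M x\<in>A. unit_uniform) (count_space (histories k))"
  using assms
proof (induction t)
  case 0
  then show ?case by (simp add: histories_def)
next
  case (Suc t)
  let ?M = "\<Pi>\<^sub>M x\<in>A. unit_uniform"
  have R: "(\<lambda>\<omega>. run q \<beta> k adv \<omega> t) \<in> measurable ?M (count_space (histories k))"
  proof (rule Suc.IH)
    have "{..<t} \<times> (UNIV :: nat set) \<subseteq> {..<Suc t} \<times> UNIV" by auto
    then show "{..<t} \<times> UNIV \<subseteq> A" using Suc.prems by (rule subset_trans)
  qed
  have C: "(\<lambda>\<omega> i. \<omega> (t, i)) \<in> measurable ?M round_coins"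
    unfolding round_coins_def
  proof (rule measurable_PiM_single')
    fix i
    have "(t, i) \<in> A" using Suc.prems by auto
    then show "(\<lambda>\<omega>. \<omega> (t, i)) \<in> measurable ?M unit_uniform" by (rule measurable_component_singleton)
  qed simp
  show ?case
    unfolding run_Suc
  proof (rule measurable_compose_countable'[where f = "\<lambda>h \<omega>. history_step q \<beta> k adv h (\<lambda>i. \<omega> (t, i))",
        OF _ R countable_histories])
    fix h assume "h \<in> histories k"
    then show "(\<lambda>\<omega>. history_step q \<beta> k adv h (\<lambda>i. \<omega> (t, i))) \<in> measurable ?M (count_space (histories k))"
      by (intro measurable_compose[OF C] measurable_history_step)
  qed
qed

lemma measurable_run_coins [measurable]:
  "(\<lambda>\<omega>. run q \<beta> k adv \<omega> t) \<in> measurable coins (count_space (histories k))"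
  unfolding coins_eq by (rule measurable_run) simp

lemma measurable_future_coins [measurable]: "(\<lambda>\<omega> i. \<omega> (t, i)) \<in> measurable coins round_coins"
  unfolding round_coins_def coins_eq
  by (intro measurable_PiM_single') (auto simp: space_PiM)

lemma indep_vars_coins:
  "prob_space.indep_vars coins (\<lambda>_. unit_uniform) (\<lambda>x \<omega>. \<omega> x) UNIV"
proof -
  interpret coins: prob_space coins by (rule prob_space_coins)
  interpret P: product_prob_space "\<lambda>_. unit_uniform" "UNIV :: (nat \<times> nat) set" by unfold_locales
  have "distr coins unit_uniform (\<lambda>\<omega>. \<omega> x) = unit_uniform" for x
    using P.PiM_component[of x] by (simp add: coins_eq)
  moreover have "distr coins coins (\<lambda>\<omega>. \<omega>) = coins" by (rule distr_id)
  ultimately show ?thesis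
    by (subst coins.indep_vars_iff_distr_eq_PiM') (simp_all add: restrict_UNIV flip: coins_eq, simp add: coins_eq)
qed

lemma distr_future_coins: "distr coins round_coins (\<lambda>\<omega> i. \<omega> (t, i)) = round_coins"
proof -
  interpret P: product_prob_space "\<lambda>_. unit_uniform" "UNIV :: nat set" by unfold_locales
  interpret Q: product_prob_space "\<lambda>_. unit_uniform" "UNIV :: (nat \<times> nat) set" by unfold_locales
  have "distr coins round_coins (\<lambda>\<omega> i. \<omega> (t, i)) = PiM UNIV (\<lambda>_. unit_uniform)"
  proof (rule P.PiM_eq)
    show "sets (distr coins round_coins (\<lambda>\<omega> i. \<omega> (t, i))) = sets (PiM UNIV (\<lambda>_. unit_uniform))"
      by (simp add: round_coins_def)
  next
    fix J :: "nat set" and F assume J: "finite J" "J \<subseteq> UNIV" and F: "\<And>j. j \<in> J \<Longrightarrow> F j \<in> sets unit_uniform"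
    let ?A = "prod_emb UNIV (\<lambda>_. unit_uniform) J (Pi\<^sub>E J F)"
    have A: "?A = {u. \<forall>j\<in>J. u j \<in> F j}" by (auto simp: prod_emb_def space_PiM PiE_iff)
    have "?A \<in> sets round_coins"
      unfolding round_coins_def using J F by (intro sets_PiM_I) auto
    then have "emeasure (distr coins round_coins (\<lambda>\<omega> i. \<omega> (t, i))) ?A
        = emeasure coins {\<omega>. \<forall>x\<in>Pair t ` J. \<omega> x \<in> F (snd x)}"
      by (subst emeasure_distr) (auto simp: A intro!: arg_cong[where f = "emeasure coins"])
    also have "\<dots> = (\<Prod>x\<in>Pair t ` J. emeasure unit_uniform (F (snd x)))"
      using Q.emeasure_PiM_Collect[of "Pair t ` J" "\<lambda>x. F (snd x)"] J F
      by (fastforce simp: coins_eq space_PiM)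
    also have "\<dots> = (\<Prod>j\<in>J. emeasure unit_uniform (F j))"
      by (subst prod.reindex) (auto simp: inj_on_def)
    finally show "emeasure (distr coins round_coins (\<lambda>\<omega> i. \<omega> (t, i))) ?A = (\<Prod>j\<in>J. emeasure unit_uniform (F j))" .
  qed
  then show ?thesis by (simp add: round_coins_def)
qed

text \<open>A Markov property: the history before round t reads only coordinates of earlier rounds,
  so by independence and Fubini fresh numbers from \<open>round_coins\<close> may replace those of
  round t.\<close>

lemma nn_integral_coins_split:
  assumes F: "\<And>h. h \<in> histories k \<Longrightarrow> F h \<in> borel_measurable round_coins"
  shows "(\<integral>\<^sup>+\<omega>. F (run q \<beta> k adv \<omega> t) (\<lambda>i. \<omega> (t, i)) \<partial>coins)
       = (\<integral>\<^sup>+\<omega>. (\<integral>\<^sup>+u. F (run q \<beta> k adv \<omega> t) u \<partial>round_coins) \<partial>coins)"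
proof -
  interpret coins: prob_space coins by (rule prob_space_coins)
  let ?H = "count_space (histories k)" and ?X = "\<lambda>\<omega>. run q \<beta> k adv \<omega> t" and ?Y = "\<lambda>\<omega> i. \<omega> (t, i)"
  let ?A = "{..<t} \<times> (UNIV :: nat set)" and ?B = "{t} \<times> (UNIV :: nat set)"
  let ?P = "PiM ?A (\<lambda>_. unit_uniform)" and ?Q = "PiM ?B (\<lambda>_. unit_uniform)"
  let ?r = "\<lambda>\<omega>. restrict \<omega> ?A" and ?s = "\<lambda>\<omega>. restrict \<omega> ?B"
  have I: "coins.indep_var ?P ?r ?Q ?s"
    using coins.indep_var_restrict[OF indep_vars_coins, of ?A ?B] by auto
  have [measurable]: "?r \<in> measurable coins ?P" "?s \<in> measurable coins ?Q"
    using coins.indep_var_rv1[OF I] coins.indep_var_rv2[OF I] by auto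
  have D: "distr coins ?P ?r \<Otimes>\<^sub>M distr coins ?Q ?s = distr coins (?P \<Otimes>\<^sub>M ?Q) (\<lambda>\<omega>. (?r \<omega>, ?s \<omega>))"
    using I by (simp only: coins.indep_var_distribution_eq)
  interpret Q: prob_space "distr coins ?Q ?s" by (rule coins.prob_space_distr) measurable
  have X: "?X \<in> measurable ?P ?H" by (rule measurable_run) simp
  have Y: "?Y \<in> measurable ?Q round_coins"
    unfolding round_coins_def
    by (intro measurable_PiM_single') (auto simp: space_PiM intro!: measurable_component_singleton)
  have Xr: "?X (?r \<omega>) = ?X \<omega>" for \<omega> by (rule run_cong) simp
  have Ys: "?Y (?s \<omega>) = ?Y \<omega>" for \<omega> by simp
  let ?G = "\<lambda>z. F (?X (fst z)) (?Y (snd z))"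
  have G: "?G \<in> borel_measurable (?P \<Otimes>\<^sub>M ?Q)"
    by (rule measurable_compose_countable'[OF _ measurable_compose[OF measurable_fst X] countable_histories])
       (rule measurable_compose[OF measurable_compose[OF measurable_snd Y] F])
  have "(\<integral>\<^sup>+\<omega>. F (?X \<omega>) (?Y \<omega>) \<partial>coins) = (\<integral>\<^sup>+\<omega>. ?G (?r \<omega>, ?s \<omega>) \<partial>coins)"
    by (simp only: fst_conv snd_conv Xr Ys)
  also have "\<dots> = (\<integral>\<^sup>+z. ?G z \<partial>(distr coins ?P ?r \<Otimes>\<^sub>M distr coins ?Q ?s))"
    unfolding D using G by (subst nn_integral_distr) auto
  also have "\<dots> = (\<integral>\<^sup>+x. \<integral>\<^sup>+y. ?G (x, y) \<partial>distr coins ?Q ?s \<partial>distr coins ?P ?r)"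
    using G by (intro Q.nn_integral_fst[symmetric]) (simp cong: measurable_cong_sets sets_pair_measure_cong)
  also have "\<dots> = (\<integral>\<^sup>+x. \<integral>\<^sup>+u. F (?X x) u \<partial>round_coins \<partial>distr coins ?P ?r)"
  proof (intro nn_integral_cong)
    fix x assume "x \<in> space (distr coins ?P ?r)"
    then have x: "x \<in> space ?P" by simp
    have Fx: "F (?X x) \<in> borel_measurable round_coins" by (rule F[OF run_histories])
    have "(\<integral>\<^sup>+y. ?G (x, y) \<partial>distr coins ?Q ?s) = (\<integral>\<^sup>+\<omega>. F (?X x) (?Y (?s \<omega>)) \<partial>coins)"
      using measurable_compose[OF Y Fx] by (subst nn_integral_distr) auto
    also have "\<dots> = (\<integral>\<^sup>+\<omega>. F (?X x) (?Y \<omega>) \<partial>coins)" by (simp only: Ys)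
    also have "\<dots> = (\<integral>\<^sup>+u. F (?X x) u \<partial>distr coins round_coins ?Y)"
      using Fx by (subst nn_integral_distr) auto
    finally show "(\<integral>\<^sup>+y. ?G (x, y) \<partial>distr coins ?Q ?s) = (\<integral>\<^sup>+u. F (?X x) u \<partial>round_coins)"
      by (simp only: distr_future_coins)
  qed
  also have "\<dots> = (\<integral>\<^sup>+\<omega>. \<integral>\<^sup>+u. F (?X (?r \<omega>)) u \<partial>round_coins \<partial>coins)"
    by (subst nn_integral_distr) (auto intro!: measurable_compose[OF X])
  also have "\<dots> = (\<integral>\<^sup>+\<omega>. \<integral>\<^sup>+u. F (?X \<omega>) u \<partial>round_coins \<partial>coins)"
    by (simp only: Xr)
  finally show ?thesis .
qed

subsection \<open>The potential and the rounds without a leader\<close>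

lemma successful_iff: "successful a i \<longleftrightarrow> (\<forall>j. a j \<noteq> None \<longleftrightarrow> j = i)"
  unfolding successful_def by blast

lemma successful_unique: "successful a i \<Longrightarrow> successful a j \<Longrightarrow> i = j"
  by (auto simp: successful_def)

lemma received_success:
  assumes "successful a l"
  shows "received a i = (if i = l then None else a l)"
proof -
  have "(THE j. successful a j) = l" using assms successful_unique by blast
  moreover have "(\<exists>j. j \<noteq> i \<and> successful a j) \<longleftrightarrow> i \<noteq> l"
    using assms successful_unique[of a _ l] by metis
  ultimately show ?thesis by (simp add: received_def)
qed

lemma received_silence: "(\<And>j. \<not> successful a j) \<Longrightarrow> received a i = None"
  by (simp add: received_def)

fun bystander :: "station \<Rightarrow> bool" where
  "bystander Asleep = True"
| "bystander (Waiting n b) = True"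
| "bystander Off = True"
| "bystander _ = False"

fun is_member :: "station \<Rightarrow> bool" where
  "is_member (Member t s) = True"
| "is_member _ = False"

fun is_electing :: "station \<Rightarrow> bool" where
  "is_electing (Electing i) = True"
| "is_electing _ = False"

fun saw_of :: "station \<Rightarrow> sawtooth" where
  "saw_of (Member t s) = s"
| "saw_of _ = saw_init"

text \<open>A waiting station that has heard nothing in its current block must have started it within the
  present gap of messageless rounds.\<close>

fun consistent :: "nat \<Rightarrow> nat \<Rightarrow> nat \<Rightarrow> nat \<Rightarrow> station \<Rightarrow> bool" where
  "consistent t W w p Asleep = True"
| "consistent t W w p (Waiting n b) = (b \<or> n \<le> gap t)"
| "consistent t W w p Off = True"
| "consistent t W w p (Member t' s) = (t' = t \<and> outer s = W \<and> width s = w \<and> pos s = p)"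
| "consistent t W w p _ = False"

lemma bystander_not_member: "bystander s \<Longrightarrow> \<not> is_member s"
  by (cases s) auto

text \<open>Members that will be left when the window ends. One that is still active although its
  slot lies before \<open>p\<close> has collided; one that will be alone in its slot is going to
  leave. Slots \<ge> w, of probability 0, count as failures.\<close>

definition survivors :: "nat \<Rightarrow> nat \<Rightarrow> nat set \<Rightarrow> (nat \<Rightarrow> nat) \<Rightarrow> nat set" where
  "survivors w p A sl = {i \<in> A. \<not> (p \<le> sl i \<and> sl i < w \<and> (\<forall>j\<in>A. sl j = sl i \<longrightarrow> j = i))}"

lemma survivors_cong: "(\<And>i. i \<in> A \<Longrightarrow> sl i = sl' i) \<Longrightarrow> survivors w p A sl = survivors w p A sl'"
  by (auto simp: survivors_def)

lemma card_survivors_le: "finite A \<Longrightarrow> card (survivors w p A sl) \<le> card A"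
  by (rule card_mono) (auto simp: survivors_def)

lemma survivors_le_collisions:
  assumes A: "finite A"
  shows "real (card (survivors w 0 A sl)) \<le>
    (\<Sum>i\<in>A. of_bool (w \<le> sl i) + (\<Sum>j\<in>A - {i}. of_bool (sl i = sl j)))"
proof -
  have "real (card (survivors w 0 A sl)) = (\<Sum>i\<in>A. of_bool (i \<in> survivors w 0 A sl))"
  proof -
    have "A \<inter> {i. i \<in> survivors w 0 A sl} = survivors w 0 A sl" by (auto simp: survivors_def)
    then show ?thesis using A by (simp add: sum_of_bool_eq)
  qed
  also have "\<dots> \<le> (\<Sum>i\<in>A. of_bool (w \<le> sl i) + (\<Sum>j\<in>A - {i}. of_bool (sl i = sl j)))"
  proof (rule sum_mono)
    fix i
    have nn: "0 \<le> (\<Sum>j\<in>A - {i}. of_bool (sl i = sl j) :: real)" by (intro sum_nonneg) auto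
    show "of_bool (i \<in> survivors w 0 A sl) \<le>
        (of_bool (w \<le> sl i) + (\<Sum>j\<in>A - {i}. of_bool (sl i = sl j)) :: real)"
    proof (cases "i \<in> survivors w 0 A sl \<and> sl i < w")
      case True
      then obtain j where j: "j \<in> A - {i}" "sl i = sl j" by (force simp: survivors_def)
      then have "1 \<le> (\<Sum>j\<in>A - {i}. of_bool (sl i = sl j) :: real)"
        using A member_le_sum[of j "A - {i}" "\<lambda>j. of_bool (sl i = sl j) :: real"] by simp
      then show ?thesis using True by simp
    next
      case False
      then show ?thesis using nn by auto
    qed
  qed
  finally show ?thesis .
qed

section \<open>The potential of a configuration\<close>

context adaptive
begin

definition participation :: real where
  "participation = early 2 2 + real (probes k 1)"

text \<open>On an election every station in L mode gives up \<open>base\<close> and keeps at most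
  \<open>participation\<close>. The power of 4 compensates the transmission rates
  (\<open>election_rate_sum\<close>), the last term pays for SUniform per member, and 20 covers the
  constants of \<open>global_pot_initial\<close>.\<close>

definition base :: real where
  "base = 4 powr (2 * q) + participation + 20 + 8 * (4 * cost_factor + 24 * cost_factor * ratio)"

text \<open>Before the slot is drawn the whole \<open>early\<close> share is held; afterwards one
  unit is kept until the slot has passed.\<close>

definition saw_pot :: "sawtooth \<Rightarrow> real" where
  "saw_pot s = (if pos s = 0 then early (outer s) (width s)
     else of_bool (pos s \<le> slot s) + early_next (outer s) (width s))"

fun pot :: "station \<Rightarrow> real" where
  "pot Asleep = base + young 0"
| "pot (Waiting n b) = base + young 0"
| "pot (Electing i) = base + young i"
| "pot (Leader t) = 0"
| "pot (Member t s) = saw_pot s + real (probes k t)"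
| "pot Off = 0"

fun young_rate :: "station \<Rightarrow> real" where
  "young_rate (Electing i) = (if i < k then rate i else 0)"
| "young_rate _ = 0"

definition members :: "(nat \<Rightarrow> station) \<Rightarrow> nat set" where
  "members c = {i. i < k \<and> is_member (c i)}"

definition quiet :: "(nat \<Rightarrow> station) \<Rightarrow> bool" where
  "quiet c \<longleftrightarrow> (\<forall>i\<ge>k. c i = Asleep) \<and> (\<forall>i<k. bystander (c i) \<or> is_electing (c i))"

text \<open>\<open>consistent\<close> admits neither a second leader nor a station in L mode, so
  this is the invariant of a single leader. The members share time, window and position and differ
  only in their slots.\<close>

definition dissemination :: "(nat \<Rightarrow> station) \<Rightarrow> nat \<Rightarrow> nat \<Rightarrow> nat \<Rightarrow> nat \<Rightarrow> nat \<Rightarrow> bool" where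
  "dissemination c l t W w p \<longleftrightarrow> (\<forall>i\<ge>k. c i = Asleep) \<and> l < k \<and> c l = Leader t \<and>
     1 \<le> t \<and> 2 \<le> W \<and> 1 \<le> w \<and> p < w \<and> (\<forall>i<k. i \<noteq> l \<longrightarrow> consistent t W w p (c i))"

text \<open>At position 0 no slot is drawn and only an expectation over the \<open>n\<close> members
  is known; afterwards the slots fix the number \<open>m\<close> left at the end of the
  window.\<close>

definition steps_left :: "nat \<Rightarrow> nat \<Rightarrow> nat \<Rightarrow> nat \<Rightarrow> nat \<Rightarrow> real" where
  "steps_left W w p n m = (if p = 0 then duration W w n else real w - real p + rest W w m)"

text \<open>Every step of SUniform takes two rounds. Each round pays 1 for the transmission of the leader,
  1 for the tail, which lasts until the next power of two, and 2 for the questions asked by the members after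
  round k.\<close>

definition global_pot :: "nat \<Rightarrow> nat \<Rightarrow> nat \<Rightarrow> nat \<Rightarrow> nat \<Rightarrow> nat \<Rightarrow> real" where
  "global_pot t W w p n m = (if n = 0 then tail t
     else probe_credit t + real t + 4 + (if even t then 4 else 0) + 8 * steps_left W w p n m)"

definition slots :: "(nat \<Rightarrow> station) \<Rightarrow> nat \<Rightarrow> nat" where
  "slots c i = slot (saw_of (c i))"

text \<open>A relation and not a function: without members, \<open>W\<close>, \<open>w\<close> and
  \<open>p\<close> cannot be read off the configuration, and every admissible choice gives a valid
  bound.\<close>

inductive certified :: "(nat \<Rightarrow> station) \<Rightarrow> real \<Rightarrow> bool" where
  quiet: "quiet c \<Longrightarrow> certified c (\<Sum>i<k. pot (c i))"
| dissemination: "dissemination c l t W w p \<Longrightarrow> certified c ((\<Sum>i<k. pot (c i)) +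
     global_pot t W w p (card (members c)) (card (survivors w p (members c) (slots c))))"

lemma finite_members [simp]: "finite (members c)"
  by (simp add: members_def)

lemma participation_nonneg: "0 \<le> participation"
  using early_nonneg[of 2 2] by (simp add: participation_def)

lemma base_ge: "4 powr (2 * q) + participation + 20 \<le> base"
  using cost_factor_ge_1 ratio_ge_2 by (simp add: base_def)

lemma base_nonneg: "0 \<le> base"
  using base_ge participation_nonneg powr_ge_zero[of 4 "2 * q"] by linarith

lemma pot_bystander_nonneg: "bystander s \<or> is_electing s \<Longrightarrow> 0 \<le> pot s"
  using base_nonneg young_nonneg by (cases s) auto

lemma saw_pot_nonneg: "1 \<le> outer s \<Longrightarrow> 1 \<le> width s \<Longrightarrow> 0 \<le> saw_pot s"
  using early_nonneg early_next_nonneg by (simp add: saw_pot_def)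

lemma pot_consistent_nonneg: "consistent t W w p s \<Longrightarrow> 1 \<le> W \<Longrightarrow> 1 \<le> w \<Longrightarrow> 0 \<le> pot s"
  using base_nonneg young_nonneg saw_pot_nonneg by (cases s) auto

lemma steps_left_nonneg: "1 \<le> W \<Longrightarrow> 1 \<le> w \<Longrightarrow> p < w \<Longrightarrow> 0 \<le> steps_left W w p n m"
  using duration_nonneg rest_nonneg by (simp add: steps_left_def)

lemma global_pot_nonneg: "1 \<le> t \<Longrightarrow> 1 \<le> W \<Longrightarrow> 1 \<le> w \<Longrightarrow> p < w \<Longrightarrow> 0 \<le> global_pot t W w p n m"
  using tail_ge_1[of t] steps_left_nonneg[of W w p n m] probe_credit_nonneg[of t]
  by (simp add: global_pot_def)

lemma certified_nonneg: "certified c v \<Longrightarrow> 0 \<le> v"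
proof (induction rule: certified.induct)
  case (quiet c)
  then show ?case by (auto intro!: sum_nonneg pot_bystander_nonneg simp: quiet_def)
next
  case (dissemination c l t W w p)
  have "0 \<le> pot (c i)" if "i < k" for i
    using that dissemination pot_consistent_nonneg[of t W w p "c i"]
    by (cases "i = l") (auto simp: dissemination_def)
  then show ?case using dissemination global_pot_nonneg[of t W w p]
    by (intro add_nonneg_nonneg sum_nonneg) (auto simp: dissemination_def)
qed

text \<open>The value of a D mode in an odd round, when \<open>sl\<close> are the slots of the members, drawn in this round or before.\<close>

definition drawn_pot :: "(nat \<Rightarrow> station) \<Rightarrow> nat \<Rightarrow> nat \<Rightarrow> nat \<Rightarrow> nat \<Rightarrow> (nat \<Rightarrow> nat) \<Rightarrow> real" where
  "drawn_pot c t W w p sl =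
     (\<Sum>i<k. if i \<in> members c then of_bool (p \<le> sl i) + early_next W w + real (probes k t) else pot (c i)) +
     probe_credit t + real t + 4 + 8 * (real w - real p + rest W w (card (survivors w p (members c) sl)))"

lemma global_pot_initial:
  assumes "n \<le> m" "1 \<le> m"
  shows "global_pot 1 2 2 0 n j \<le> 15 + 8 * (4 * cost_factor + 24 * cost_factor * ratio) * real m"
proof -
  define X where "X = 4 * cost_factor + 24 * cost_factor * ratio"
  have K: "0 \<le> 4 * cost_factor" "0 \<le> 24 * cost_factor * ratio"
    using cost_factor_ge_1 ratio_ge_2 by auto
  have "later 2 n \<le> 4 * cost_factor * 1 + 24 * cost_factor * ratio * real n"
    using K by (simp add: later_def)
  also have "\<dots> \<le> 4 * cost_factor * real m + 24 * cost_factor * ratio * real m"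
    using K assms by (intro add_mono mult_left_mono) auto
  also have "\<dots> = X * real m" by (simp add: X_def algebra_simps)
  finally have "8 * duration 2 2 n \<le> 8 * X * real m"
    using duration_le_later[of 2 n] by simp
  moreover have "0 \<le> 8 * X * real m" using K by (simp add: X_def)
  moreover have "probe_credit 1 = 2" using not_probe_0 by simp
  ultimately have "global_pot 1 2 2 0 n j \<le> 15 + 8 * X * real m" using tail_le[of 1]
    by (simp add: global_pot_def steps_left_def)
  then show ?thesis by (simp add: X_def)
qed

lemma next_states_ge:
  assumes "\<forall>i\<ge>k. current h i = Asleep" "k \<le> i"
  shows "next_states q \<beta> k adv u h i = Asleep"
  using assms by (simp add: next_states_def)

lemma actions_ge:
  assumes "\<forall>i\<ge>k. current h i = Asleep" "k \<le> i"
  shows "actions q u h i = None"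
  using assms by (simp add: actions_def)

section \<open>Rounds without a leader\<close>

lemma quiet_action:
  assumes "quiet (current h)" "actions q u h i \<noteq> None"
  obtains e where "i < k" "current h i = Electing e" "actions q u h i = Some Packet" "u i < rate e"
proof -
  have "i < k" using assms actions_ge[of h i u] by (force simp: quiet_def)
  moreover obtain e where "current h i = Electing e"
    using assms \<open>i < k\<close> by (cases "current h i") (auto simp: quiet_def actions_def)
  ultimately show thesis using that assms by (auto simp: actions_def rate_def split: if_splits)
qed

text \<open>All stations in L mode learn of the success in the same round and start D mode
  synchronously. Each, the leader included, releases at least base - participation; as there is at
  least one, this pays the new \<open>global_pot\<close> and leaves 4 powr (2 * q) over.\<close>

lemma quiet_success:
  assumes c: "quiet (current h)" and l: "successful (actions q u h) l"
  shows "\<exists>v. certified (next_states q \<beta> k adv u h) v \<and>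
    1 + v \<le> (\<Sum>i<k. pot (current h i) - 2 * young_rate (current h i)) + 1 - 4 powr (2 * q)"
proof -
  let ?c = "current h" and ?d = "next_states q \<beta> k adv u h" and ?a = "actions q u h"
  let ?E = "{i. i < k \<and> is_electing (?c i)}"
  have "?a l \<noteq> None" using l by (auto simp: successful_def)
  then obtain e where e: "l < k" "?c l = Electing e" "?a l = Some Packet"
    using quiet_action[OF c] by metis
  have succ: "successful ?a i \<longleftrightarrow> i = l" for i using l successful_unique by blast
  have rcv: "received ?a i = (if i = l then None else Some Packet)" for i
    using received_success[OF l] e by simp
  have dl: "?d l = Leader 1" using e by (simp add: next_states_def succ)
  have d: "(is_electing (?c i) \<and> ?d i = Member 1 saw_init) \<or>
      (bystander (?c i) \<and> bystander (?d i) \<and> consistent 1 2 2 0 (?d i) \<and> pot (?d i) = pot (?c i))"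
    if "i < k" "i \<noteq> l" for i
  proof -
    have "bystander (?c i) \<or> is_electing (?c i)" using c that by (simp add: quiet_def)
    then show ?thesis using that by (cases "?c i") (auto simp: next_states_def succ rcv)
  qed
  have D: "dissemination ?d l 1 2 2 0"
    unfolding dissemination_def
  proof (intro conjI allI impI)
    fix i assume "i < k" "i \<noteq> l"
    then show "consistent 1 2 2 0 (?d i)" using d[of i] by (auto simp: saw_init_def)
  qed (use dl e(1) next_states_ge c in \<open>auto simp: quiet_def\<close>)
  let ?n = "card (members ?d)" and ?m = "card ?E"
  have lE: "l \<in> ?E" using e by simp
  have "members ?d \<subseteq> ?E"
  proof
    fix i assume "i \<in> members ?d"
    then have i: "i < k" "is_member (?d i)" by (auto simp: members_def)
    then have "i \<noteq> l" using dl by auto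
    then show "i \<in> ?E" using d[of i] i bystander_not_member by auto
  qed
  then have n: "?n \<le> ?m" by (intro card_mono) auto
  have m: "1 \<le> ?m" using card_mono[of ?E "{l}"] lE by simp
  have pi: "pot (Member 1 saw_init) = participation"
    by (simp add: participation_def saw_pot_def saw_init_def)
  have "pot (?d i) \<le> pot (?c i) - 2 * young_rate (?c i) - of_bool (is_electing (?c i)) * (base - participation)"
    if "i < k" for i
  proof (cases "is_electing (?c i)")
    case True
    then obtain j where j: "?c i = Electing j" by (cases "?c i") auto
    have "pot (?d i) \<le> participation"
      using d[OF that] dl j pi participation_nonneg by (cases "i = l") auto
    moreover have "2 * young_rate (?c i) \<le> young j"
      using young_Suc[of j] young_nonneg[of "Suc j"] young_nonneg[of j] by (simp add: j)
    ultimately show ?thesis by (simp add: j)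
  next
    case False
    then have "pot (?d i) = pot (?c i)" "young_rate (?c i) = 0"
      using d[OF that] e(2) by (cases "i = l"; cases "?c i"; force)+
    then show ?thesis using False by simp
  qed
  then have "(\<Sum>i<k. pot (?d i)) \<le> (\<Sum>i<k. pot (?c i) - 2 * young_rate (?c i) -
      of_bool (is_electing (?c i)) * (base - participation))"
    by (intro sum_mono) auto
  also have "\<dots> = (\<Sum>i<k. pot (?c i) - 2 * young_rate (?c i)) - real ?m * (base - participation)"
    by (simp add: sum_subtractf real_card_filter sum_distrib_right)
  finally have S: "(\<Sum>i<k. pot (?d i)) \<le>
      (\<Sum>i<k. pot (?c i) - 2 * young_rate (?c i)) - real ?m * (base - participation)" .
  let ?v = "(\<Sum>i<k. pot (?d i)) + global_pot 1 2 2 0 ?n (card (survivors 2 0 (members ?d) (slots ?d)))"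
  have "1 * (4 powr (2 * q) + 20) \<le> real ?m * (4 powr (2 * q) + 20)"
    using m by (intro mult_right_mono) auto
  then have "4 powr (2 * q) + 20 + 8 * (4 * cost_factor + 24 * cost_factor * ratio) * real ?m \<le> real ?m * (base - participation)"
    by (simp add: base_def algebra_simps)
  then have "1 + ?v \<le> (\<Sum>i<k. pot (?c i) - 2 * young_rate (?c i)) + 1 - 4 powr (2 * q)"
    using S global_pot_initial[OF n m, of "card (survivors 2 0 (members ?d) (slots ?d))"] by linarith
  then show ?thesis using certified.dissemination[OF D] by blast
qed

lemma quiet_failure:
  assumes c: "quiet (current h)" and l: "\<And>l. \<not> successful (actions q u h) l"
  shows "\<exists>v. certified (next_states q \<beta> k adv u h) v \<and>
    v \<le> (\<Sum>i<k. pot (current h i) - 2 * young_rate (current h i))"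
proof -
  let ?c = "current h" and ?d = "next_states q \<beta> k adv u h" and ?a = "actions q u h"
  have rcv: "received ?a i = None" for i by (rule received_silence[OF l])
  have d: "(bystander (?d i) \<or> is_electing (?d i)) \<and> pot (?d i) \<le> pot (?c i) - 2 * young_rate (?c i)"
    if "i < k" for i
  proof -
    have "bystander (?c i) \<or> is_electing (?c i)" using c that by (simp add: quiet_def)
    then show ?thesis
    proof (cases "?c i")
      case (Electing j)
      then show ?thesis using young_Suc[of j] by (simp add: next_states_def rcv l)
    qed (auto simp: next_states_def rcv l)
  qed
  have "quiet ?d" using d next_states_ge c by (auto simp: quiet_def)
  moreover have "(\<Sum>i<k. pot (?d i)) \<le> (\<Sum>i<k. pot (?c i) - 2 * young_rate (?c i))"
    using d by (intro sum_mono) auto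
  ultimately show ?thesis using certified.quiet by blast
qed

text \<open>Both outcomes in one formula that is affine in the indicators of the transmissions and
  of a unique one, so that it can be integrated termwise.\<close>

lemma quiet_round:
  assumes c: "quiet (current h)"
  shows "\<exists>v. certified (next_states q \<beta> k adv u h) v \<and>
    real (card {i. i < k \<and> actions q u h i \<noteq> None}) + v \<le>
      (\<Sum>i<k. pot (current h i) - 2 * young_rate (current h i)) +
      (\<Sum>i<k. of_bool (actions q u h i \<noteq> None)) -
      4 powr (2 * q) * of_bool (\<exists>!i. i < k \<and> actions q u h i \<noteq> None)"
proof (cases "\<exists>l. successful (actions q u h) l")
  case True
  then obtain l where l: "successful (actions q u h) l" by blast
  then have a: "actions q u h i \<noteq> None \<longleftrightarrow> i = l" for i by (auto simp: successful_def)
  have "l < k"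
  proof (rule ccontr)
    assume "\<not> l < k"
    then have "actions q u h l = None" using actions_ge[of h l u] c by (simp add: quiet_def)
    then show False using a by blast
  qed
  then have b: "i < k \<and> actions q u h i \<noteq> None \<longleftrightarrow> i = l" for i using a by blast
  then have "card {i. i < k \<and> actions q u h i \<noteq> None} = 1" by simp
  moreover have "(\<Sum>i<k. of_bool (actions q u h i \<noteq> None)) = (1::real)"
    using calculation real_card_filter[of k "\<lambda>i. actions q u h i \<noteq> None"] by simp
  moreover have "\<exists>!i. i < k \<and> actions q u h i \<noteq> None" unfolding b by simp
  ultimately show ?thesis
    using quiet_success[OF c l] by (simp only: of_bool_eq of_nat_1 mult_1_right)
next
  case False
  have "\<not> (\<exists>!i. i < k \<and> actions q u h i \<noteq> None)"
  proof
    assume "\<exists>!i. i < k \<and> actions q u h i \<noteq> None"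
    then obtain l where l: "\<And>i. (i < k \<and> actions q u h i \<noteq> None) \<longleftrightarrow> i = l" by metis
    have "i < k" if "actions q u h i \<noteq> None" for i
    proof (rule ccontr)
      assume "\<not> i < k"
      then have "actions q u h i = None" using actions_ge[of h i u] c by (simp add: quiet_def)
      then show False using that by blast
    qed
    then have "actions q u h i \<noteq> None \<longleftrightarrow> i = l" for i using l by metis
    then have "{i. actions q u h i \<noteq> None} = {l}" by blast
    then show False using False unfolding successful_def by blast
  qed
  moreover have "real (card {i. i < k \<and> actions q u h i \<noteq> None}) = (\<Sum>i<k. of_bool (actions q u h i \<noteq> None))"
    by (rule real_card_filter)
  ultimately show ?thesis using quiet_failure[OF c, of u] False
    by (simp only: of_bool_eq mult_zero_right) auto
qed

end

subsection \<open>Rounds of D mode\<close>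

context adaptive
begin

text \<open>A block without messages is never completed: in a silent round \<open>gap_silent\<close>
  keeps the counter within the gap and below 4, and in any other round a message marks the
  block.\<close>

lemma bystander_step:
  assumes "bystander s" "consistent t W w p s" "1 \<le> t"
    "r \<noteq> Some Anybody_out_there" "r = None \<Longrightarrow> odd t \<or> probe_round t"
  shows "bystander (update \<beta> x False r s) \<and> consistent (Suc t) W' w' p' (update \<beta> x False r s) \<and>
    pot (update \<beta> x False r s) = pot s"
proof (cases s)
  case (Waiting n b)
  show ?thesis
  proof (cases "b \<or> r \<noteq> None")
    case True
    then show ?thesis using assms by (auto simp: Waiting)
  next
    case False
    then have "odd t \<or> probe_round t" "n \<le> gap t" using assms by (auto simp: Waiting)
    then show ?thesis using gap_silent[of t] assms False by (auto simp: Waiting)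
  qed
qed (use assms in auto)

lemma dissemination_cases:
  assumes "dissemination c l t W w p" "i < k" "i \<noteq> l"
  obtains "bystander (c i)" "consistent t W w p (c i)" "i \<notin> members c"
  | z where "i \<in> members c" "c i = Member t z" "outer z = W" "width z = w" "pos z = p"
proof -
  have "consistent t W w p (c i)" using assms by (simp add: dissemination_def)
  then show thesis
    using that assms(2) by (cases "c i") (auto simp: members_def)
qed

lemma leader_not_member: "dissemination c l t W w p \<Longrightarrow> l \<notin> members c"
  by (auto simp: dissemination_def members_def)

lemma dissemination_member:
  assumes "dissemination c l t W w p" "i \<in> members c"
  obtains z where "i < k" "i \<noteq> l" "c i = Member t z" "outer z = W" "width z = w" "pos z = p" "saw_of (c i) = z"
proof -
  have "i < k" "i \<noteq> l" using assms leader_not_member by (auto simp: members_def)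
  then show thesis
    using assms(2) that by (cases rule: dissemination_cases[OF assms(1) \<open>i < k\<close> \<open>i \<noteq> l\<close>]) auto
qed

lemma dissemination_action:
  assumes "dissemination (current h) l t W w p"
  shows "actions q u h l = (if odd t then None else if probe_round t then Some Anybody_out_there else Some D_mode)"
    and "i \<in> members (current h) \<Longrightarrow> actions q u h i =
      (if odd t then (if saw_slot (u i) (saw_of (current h i)) = p then Some Packet else None)
       else if probe_round t then Some Anybody_out_there else None)"
    and "i \<noteq> l \<Longrightarrow> i \<notin> members (current h) \<Longrightarrow> actions q u h i = None"
proof -
  show "actions q u h l = (if odd t then None else if probe_round t then Some Anybody_out_there else Some D_mode)"
    using assms by (auto simp: dissemination_def actions_def)
  show "i \<in> members (current h) \<Longrightarrow> actions q u h i =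
      (if odd t then (if saw_slot (u i) (saw_of (current h i)) = p then Some Packet else None)
       else if probe_round t then Some Anybody_out_there else None)"
    using assms by (elim dissemination_member[OF assms]) (auto simp: actions_def saw_transmits_def)
  show "actions q u h i = None" if "i \<noteq> l" "i \<notin> members (current h)"
  proof (cases "i < k")
    case True
    then have "bystander (current h i)" using that by (elim dissemination_cases[OF assms]) auto
    then show ?thesis by (cases "current h i") (auto simp: actions_def)
  next
    case False
    then show ?thesis using actions_ge[of h i u] assms by (auto simp: dissemination_def)
  qed
qed

text \<open>The part common to all rounds in which D mode goes on: bystanders preserve the invariant
  by themselves, so only the leader, the members and the received messages have to be
  examined.\<close>

lemma dissemination_next:
  assumes D: "dissemination (current h) l t W w p"
    and lead: "next_states q \<beta> k adv u h l = Leader (Suc t)"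
    and rcv: "\<And>i. i \<noteq> l \<Longrightarrow> i \<notin> members (current h) \<Longrightarrow> received (actions q u h) i \<noteq> Some Anybody_out_there \<and>
      (received (actions q u h) i = None \<longrightarrow> odd t \<or> probe_round t)"
    and mem: "\<And>i. i \<in> members (current h) \<Longrightarrow> next_states q \<beta> k adv u h i = Off \<or>
      (\<exists>z. next_states q \<beta> k adv u h i = Member (Suc t) z \<and> outer z = W' \<and> width z = w' \<and> pos z = p')"
    and W: "2 \<le> W'" "1 \<le> w'" "p' < w'"
  shows "dissemination (next_states q \<beta> k adv u h) l (Suc t) W' w' p'"
    and "members (next_states q \<beta> k adv u h) = {i \<in> members (current h). next_states q \<beta> k adv u h i \<noteq> Off}"
    and "\<And>i. i \<notin> members (current h) \<Longrightarrow> pot (next_states q \<beta> k adv u h i) = pot (current h i)"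
proof -
  let ?c = "current h" and ?d = "next_states q \<beta> k adv u h" and ?a = "actions q u h"
  have l: "l < k" "?c l = Leader t" "1 \<le> t" and ge: "\<forall>i\<ge>k. ?c i = Asleep"
    using D by (auto simp: dissemination_def)
  have b: "bystander (?d i) \<and> consistent (Suc t) W' w' p' (?d i) \<and> pot (?d i) = pot (?c i)"
    if "i < k" "i \<noteq> l" "i \<notin> members ?c" for i
  proof -
    have bs: "bystander (?c i)" "consistent t W w p (?c i)"
      using that by (auto elim: dissemination_cases[OF D])
    have s: "\<not> successful ?a i"
      using dissemination_action(3)[OF D that(2,3), of u] unfolding successful_iff by blast
    show ?thesis
    proof (cases "?c i = Asleep \<and> i < k \<and> i \<in> adv h")
      case True
      then show ?thesis by (simp add: next_states_def)
    next
      case False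
      then have "?d i = update \<beta> (u i) False (received ?a i) (?c i)" by (simp add: next_states_def s)
      then show ?thesis using bystander_step[OF bs l(3), of "received ?a i"] rcv[of i] that by auto
    qed
  qed
  have m: "?d i = Off \<or> is_member (?d i) \<and> consistent (Suc t) W' w' p' (?d i)" if "i \<in> members ?c" for i
    using mem[OF that] by auto
  have sub: "members ?c \<subseteq> {..<k}" by (auto simp: members_def)
  show "dissemination ?d l (Suc t) W' w' p'"
    unfolding dissemination_def
  proof (intro conjI allI impI)
    fix i assume "i < k" "i \<noteq> l"
    then show "consistent (Suc t) W' w' p' (?d i)" using b[of i] m[of i] by (cases "i \<in> members ?c") auto
  qed (use l lead W next_states_ge[OF ge] in auto)
  show "members ?d = {i \<in> members ?c. ?d i \<noteq> Off}"
  proof (intro set_eqI iffI)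
    fix i assume i: "i \<in> members ?d"
    then have "i < k" "is_member (?d i)" by (auto simp: members_def)
    then have "i \<noteq> l" "\<not> bystander (?d i)" using lead bystander_not_member by auto
    then have "i \<in> members ?c" using b \<open>i < k\<close> by auto
    then show "i \<in> {i \<in> members ?c. ?d i \<noteq> Off}" using \<open>is_member (?d i)\<close> by auto
  next
    fix i assume "i \<in> {i \<in> members ?c. ?d i \<noteq> Off}"
    then show "i \<in> members ?d" using m[of i] sub by (auto simp: members_def)
  qed
  show "pot (?d i) = pot (?c i)" if "i \<notin> members ?c" for i
  proof (cases "i < k \<and> i \<noteq> l")
    case True
    then show ?thesis using b that by auto
  next
    case False
    then show ?thesis using next_states_ge[OF ge] ge l lead by (cases "i = l") auto
  qed
qed

text \<open>The leader has the channel to itself, so its next question succeeds and ends D mode;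
  until then a round costs at most one transmission, paid by \<open>tail\<close>.\<close>

lemma idle_round:
  assumes D: "dissemination (current h) l t W w p" and M: "members (current h) = {}"
  shows "\<exists>v. certified (next_states q \<beta> k adv u h) v \<and>
    real (card {i. i < k \<and> actions q u h i \<noteq> None}) + v \<le> (\<Sum>i<k. pot (current h i)) + tail t"
proof -
  let ?c = "current h" and ?d = "next_states q \<beta> k adv u h" and ?a = "actions q u h"
  have l: "l < k" "?c l = Leader t" "1 \<le> t" and ge: "\<forall>i\<ge>k. ?c i = Asleep" and W: "2 \<le> W" "1 \<le> w" "p < w"
    using D by (auto simp: dissemination_def)
  have a: "?a i = None" if "i \<noteq> l" for i using dissemination_action(3)[OF D that] M by simp
  have al: "?a l = (if odd t then None else if probe_round t then Some Anybody_out_there else Some D_mode)"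
    by (rule dissemination_action(1)[OF D])
  have aiff: "?a j \<noteq> None \<longleftrightarrow> j = l \<and> even t" for j using a al by (cases "j = l") auto
  have succ: "successful ?a i \<longleftrightarrow> i = l \<and> even t" for i
    unfolding successful_iff aiff by blast
  show ?thesis
  proof (cases "probe_round t")
    case True
    then have e: "even t" by (rule probe_even)
    have rcv: "received ?a i = (if i = l then None else Some Anybody_out_there)" for i
      using received_success[of ?a l] succ e al True by simp
    have dl: "?d l = Off" using l True e by (simp add: next_states_def succ)
    \<comment> \<open>Waiting stations hear the question and enter L mode at no charge:
      \<open>Waiting\<close> and \<open>Electing 0\<close> have the same potential.\<close>
    have d: "(bystander (?d i) \<or> is_electing (?d i)) \<and> pot (?d i) = pot (?c i)" if "i < k" for i
    proof (cases "i = l")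
      case True
      then show ?thesis using dl l by simp
    next
      case False
      then have "bystander (?c i)" using that M by (elim dissemination_cases[OF D]) auto
      then show ?thesis using False by (cases "?c i") (auto simp: next_states_def succ rcv)
    qed
    have "certified ?d (\<Sum>i<k. pot (?d i))"
      using d next_states_ge[OF ge] by (intro certified.quiet) (auto simp: quiet_def)
    moreover have "{i. i < k \<and> ?a i \<noteq> None} = {l}" unfolding aiff using l e by blast
    moreover have "(\<Sum>i<k. pot (?d i)) = (\<Sum>i<k. pot (?c i))" using d by (intro sum.cong) auto
    ultimately show ?thesis using tail_ge_1[OF l(3)] by auto
  next
    case False
    have rcv: "received ?a i = (if i = l \<or> odd t then None else Some D_mode)" for i
    proof (cases "even t")
      case True
      then show ?thesis using received_success[of ?a l i] succ al False by simp
    next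
      case odd: False
      then have "received ?a i = None" using succ by (intro received_silence) simp
      then show ?thesis using odd by simp
    qed
    have dl: "?d l = Leader (Suc t)" using l False by (simp add: next_states_def)
    have D': "dissemination ?d l (Suc t) W w p" "members ?d = {}" "\<And>i. pot (?d i) = pot (?c i)"
      using dissemination_next[OF D dl, of W w p] M W rcv by auto
    have "{i. i < k \<and> ?a i \<noteq> None} \<subseteq> {l}" using aiff by blast
    then have "card {i. i < k \<and> ?a i \<noteq> None} \<le> card {l}" by (intro card_mono) auto
    then have "real (card {i. i < k \<and> ?a i \<noteq> None}) \<le> 1" by simp
    then have "real (card {i. i < k \<and> ?a i \<noteq> None}) + ((\<Sum>i<k. pot (?c i)) + tail (Suc t)) \<le>
        (\<Sum>i<k. pot (?c i)) + tail t"
      using tail_Suc[OF False] by linarith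
    moreover have "(\<Sum>i<k. pot (?d i)) = (\<Sum>i<k. pot (?c i))" by (intro sum.cong refl D'(3))
    then have "certified ?d ((\<Sum>i<k. pot (?c i)) + tail (Suc t))"
      using certified.dissemination[OF D'(1)] unfolding D'(2) by (simp only: global_pot_def card.empty if_True simp_thms)
    ultimately show ?thesis by blast
  qed
qed

text \<open>While a member is left every question collides, as both it and the leader transmit; so D
  mode goes on and no waiting station hears the question. The 4 held for even rounds pay for the
  leader, the growth of t and 2 units of credit.\<close>

lemma even_round:
  assumes D: "dissemination (current h) l t W w p" and M: "members (current h) \<noteq> {}" and t: "even t"
  shows "\<exists>v. certified (next_states q \<beta> k adv u h) v \<and>
    real (card {i. i < k \<and> actions q u h i \<noteq> None}) + v \<le> (\<Sum>i<k. pot (current h i)) +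
      global_pot t W w p (card (members (current h)))
        (card (survivors w p (members (current h)) (slots (current h))))"
proof -
  let ?c = "current h" and ?d = "next_states q \<beta> k adv u h" and ?a = "actions q u h"
  let ?M = "members ?c"
  have l: "l < k" "?c l = Leader t" "1 \<le> t" and W: "2 \<le> W" "1 \<le> w" "p < w"
    using D by (auto simp: dissemination_def)
  have lM: "l \<notin> ?M" by (rule leader_not_member[OF D])
  have a: "?a i \<noteq> None \<longleftrightarrow> i = l \<or> (probe_round t \<and> i \<in> ?M)" for i
    using dissemination_action[OF D] t lM by (cases "i = l"; cases "i \<in> ?M") auto
  have al: "?a l = (if probe_round t then Some Anybody_out_there else Some D_mode)"
    using dissemination_action(1)[OF D] t by simp
  have succ: "successful ?a i \<longleftrightarrow> i = l \<and> \<not> probe_round t" for i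
  proof (cases "probe_round t")
    case True
    obtain j where "j \<in> ?M" using M by blast
    then have "?a j \<noteq> None" "?a l \<noteq> None" "j \<noteq> l" using a True lM by blast+
    then have "\<not> successful ?a i" unfolding successful_iff by metis
    then show ?thesis using True by simp
  next
    case False
    then have "{j. ?a j \<noteq> None} = {l}" using a by blast
    then show ?thesis using False by (auto simp: successful_def)
  qed
  have rcv: "received ?a i = (if i = l \<or> probe_round t then None else Some D_mode)" for i
  proof (cases "probe_round t")
    case True
    then have "received ?a i = None" using succ by (intro received_silence) simp
    then show ?thesis using True by simp
  next
    case False
    then show ?thesis using received_success[of ?a l i] succ al by simp
  qed
  have dl: "?d l = Leader (Suc t)" using l by (simp add: next_states_def succ)
  have dm: "?d i = Member (Suc t) (saw_of (?c i)) \<and> ?c i = Member t (saw_of (?c i)) \<and>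
      outer (saw_of (?c i)) = W \<and> width (saw_of (?c i)) = w \<and> pos (saw_of (?c i)) = p" if "i \<in> ?M" for i
    using that t by (elim dissemination_member[OF D]) (auto simp: next_states_def succ)
  have "i \<in> ?M \<Longrightarrow> ?d i \<noteq> Off" for i using dm[of i] by auto
  then have D': "dissemination ?d l (Suc t) W w p" "members ?d = ?M" "\<And>i. i \<notin> ?M \<Longrightarrow> pot (?d i) = pot (?c i)"
    using dissemination_next[OF D dl, of W w p] W rcv dm by auto
  have sl: "survivors w p ?M (slots ?d) = survivors w p ?M (slots ?c)"
    using dm by (intro survivors_cong) (simp add: slots_def)
  let ?b = "of_bool (probe_round t \<and> t \<le> k) :: real"
  have "pot (?d i) + ?b * of_bool (is_member (?c i)) = pot (?c i)" if "i < k" for i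
  proof (cases "i \<in> ?M")
    case True
    then have "is_member (?c i)" by (simp add: members_def)
    moreover obtain z where "?d i = Member (Suc t) z" "?c i = Member t z" using dm[OF True] by blast
    ultimately show ?thesis using probes_Suc[of k t] by simp
  next
    case False
    then show ?thesis using D'(3)[OF False] that by (simp add: members_def)
  qed
  then have S: "(\<Sum>i<k. pot (?c i)) = (\<Sum>i<k. pot (?d i) + ?b * of_bool (is_member (?c i)))"
    by (intro sum.cong) auto
  have "real (card ?M) = (\<Sum>i<k. of_bool (is_member (?c i)))"
    unfolding members_def by (rule real_card_filter)
  then have S: "(\<Sum>i<k. pot (?c i)) = (\<Sum>i<k. pot (?d i)) + ?b * real (card ?M)"
    unfolding S by (simp add: sum.distrib flip: sum_distrib_left)
  have "{i. i < k \<and> ?a i \<noteq> None} = insert l (if probe_round t then ?M else {})"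
    using a l by (auto simp: members_def)
  then have A: "real (card {i. i < k \<and> ?a i \<noteq> None}) = 1 + of_bool (probe_round t) * real (card ?M)"
    using lM by simp
  have "card ?M \<le> card {..<k}" by (intro card_mono) (auto simp: members_def)
  \<comment> \<open>After round k a question is asked by at most k < t \<le>
    \<open>probe_credit t\<close> members.\<close>
  then have "of_bool (probe_round t) * real (card ?M) - ?b * real (card ?M) + probe_credit (Suc t) \<le> probe_credit t + 2"
    using probe_credit_probe[of t] by auto
  moreover have "card ?M \<noteq> 0" using M by simp
  ultimately have "real (card {i. i < k \<and> ?a i \<noteq> None}) +
      ((\<Sum>i<k. pot (?d i)) + global_pot (Suc t) W w p (card (members ?d)) (card (survivors w p (members ?d) (slots ?d))))
      \<le> (\<Sum>i<k. pot (?c i)) + global_pot t W w p (card ?M) (card (survivors w p ?M (slots ?c)))"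
    using t unfolding A S D'(2) sl global_pot_def by simp
  then show ?thesis using certified.dissemination[OF D'(1)] by blast
qed

text \<open>Holds for each outcome of the draw; the expectation over the slots is taken later. One
  step of SUniform frees 8, of which 1 goes into t, 2 into the credit and 4 into the coming even
  round.\<close>

lemma odd_round:
  assumes D: "dissemination (current h) l t W w p" and M: "members (current h) \<noteq> {}" and t: "odd t"
  shows "\<exists>v. certified (next_states q \<beta> k adv u h) v \<and>
    real (card {i. i < k \<and> actions q u h i \<noteq> None}) + v \<le>
      drawn_pot (current h) t W w p (\<lambda>i. saw_slot (u i) (saw_of (current h i)))"
proof -
  let ?c = "current h" and ?d = "next_states q \<beta> k adv u h" and ?a = "actions q u h"
  let ?M = "members ?c"
  define sl where "sl i = saw_slot (u i) (saw_of (?c i))" for i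
  define T where "T = {i \<in> ?M. sl i = p}"
  define M' where "M' = {i \<in> ?M. \<not> successful ?a i}"
  have l: "l < k" "?c l = Leader t" "1 \<le> t" and W: "2 \<le> W" "1 \<le> w" "p < w"
    using D by (auto simp: dissemination_def)
  have np: "\<not> probe_round t" using t probe_even by blast
  have lM: "l \<notin> ?M" by (rule leader_not_member[OF D])
  have a: "?a i = (if i \<in> T then Some Packet else None)" for i
    using dissemination_action[OF D] t lM by (cases "i = l"; cases "i \<in> ?M") (auto simp: T_def sl_def)
  have aT: "?a i \<noteq> None \<longleftrightarrow> i \<in> T" for i by (simp add: a)
  have succ: "successful ?a i \<longleftrightarrow> T = {i}" for i
    unfolding successful_def aT by simp
  have rcv: "received ?a i \<noteq> Some Anybody_out_there" for i
  proof (cases "\<exists>j. successful ?a j")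
    case True
    then obtain j where "successful ?a j" by blast
    then have "received ?a i = (if i = j then None else ?a j)" by (rule received_success)
    then show ?thesis using a[of j] by auto
  next
    case False
    then have "received ?a i = None" by (intro received_silence) blast
    then show ?thesis by simp
  qed
  have "\<not> successful ?a l" using lM by (auto simp: succ T_def)
  then have dl: "?d l = Leader (Suc t)" using l by (simp add: next_states_def)
  have cm: "outer (saw_of (?c i)) = W \<and> width (saw_of (?c i)) = w \<and> pos (saw_of (?c i)) = p" if "i \<in> ?M" for i
    using that by (elim dissemination_member[OF D]) auto
  have dm: "?d i = (if successful ?a i then Off else Member (Suc t) (saw_next \<beta> (u i) (saw_of (?c i))))"
    if "i \<in> ?M" for i
    using that t by (elim dissemination_member[OF D]) (auto simp: next_states_def)
  have lone: "T = {i}" if "i \<in> ?M" "sl i = p" "\<forall>j\<in>?M. sl j = sl i \<longrightarrow> j = i" for i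
  proof -
    have "j = i" if "j \<in> T" for j
    proof -
      have "j \<in> ?M" "sl j = sl i" using that \<open>sl i = p\<close> by (simp_all add: T_def)
      then show ?thesis using \<open>\<forall>j\<in>?M. sl j = sl i \<longrightarrow> j = i\<close> by blast
    qed
    moreover have "i \<in> T" using \<open>i \<in> ?M\<close> \<open>sl i = p\<close> by (simp add: T_def)
    ultimately show ?thesis by blast
  qed
  obtain W' w' p' where W': "2 \<le> W'" "1 \<le> w'" "p' < w'"
    and nx: "\<And>i. i \<in> ?M \<Longrightarrow> outer (saw_next \<beta> (u i) (saw_of (?c i))) = W' \<and>
        width (saw_next \<beta> (u i) (saw_of (?c i))) = w' \<and> pos (saw_next \<beta> (u i) (saw_of (?c i))) = p' \<and>
        of_bool (i \<in> T) + saw_pot (saw_next \<beta> (u i) (saw_of (?c i))) \<le> of_bool (p \<le> sl i) + early_next W w"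
    and st: "steps_left W' w' p' (card M') (card (survivors w' p' M' (slots ?d))) + 1 \<le>
        real w - real p + rest W w (card (survivors w p ?M sl))"
  proof (cases "Suc p < w")
    case True
    show thesis
    proof (rule that[of W w "Suc p"])
      fix i assume i: "i \<in> ?M"
      then have "saw_next \<beta> (u i) (saw_of (?c i)) = Sawtooth W w (Suc p) (sl i)"
        using cm[OF i] True by (simp add: saw_next_def sl_def)
      then show "outer (saw_next \<beta> (u i) (saw_of (?c i))) = W \<and>
        width (saw_next \<beta> (u i) (saw_of (?c i))) = w \<and> pos (saw_next \<beta> (u i) (saw_of (?c i))) = Suc p \<and>
        of_bool (i \<in> T) + saw_pot (saw_next \<beta> (u i) (saw_of (?c i))) \<le> of_bool (p \<le> sl i) + early_next W w"
        by (auto simp: saw_pot_def T_def)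
    next
      have "slots ?d i = sl i" if "i \<in> M'" for i
        using that dm[of i] cm[of i] True by (simp add: M'_def slots_def sl_def saw_next_def)
      then have "survivors w (Suc p) M' (slots ?d) = survivors w (Suc p) M' sl"
        by (rule survivors_cong)
      \<comment> \<open>A member alone in slot p has just succeeded and is gone, so moving on to p +
        1 creates no new survivors.\<close>
      also have "\<dots> \<subseteq> survivors w p ?M sl"
      proof
        fix i assume i: "i \<in> survivors w (Suc p) M' sl"
        then have "i \<in> M'" unfolding survivors_def by blast
        then have iM: "i \<in> ?M" "T \<noteq> {i}" unfolding M'_def succ by blast+
        have "\<not> (p \<le> sl i \<and> sl i < w \<and> (\<forall>j\<in>?M. sl j = sl i \<longrightarrow> j = i))"
        proof
          assume s: "p \<le> sl i \<and> sl i < w \<and> (\<forall>j\<in>?M. sl j = sl i \<longrightarrow> j = i)"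
          have "sl i \<noteq> p"
          proof
            assume "sl i = p"
            then show False using lone[of i] s iM by blast
          qed
          then have "Suc p \<le> sl i" using s by simp
          moreover have "\<forall>j\<in>M'. sl j = sl i \<longrightarrow> j = i" using s unfolding M'_def by blast
          ultimately show False using s i unfolding survivors_def by blast
        qed
        then show "i \<in> survivors w p ?M sl" using iM by (simp add: survivors_def)
      qed
      finally have "card (survivors w (Suc p) M' (slots ?d)) \<le> card (survivors w p ?M sl)"
        by (intro card_mono) (auto simp: survivors_def)
      then show "steps_left W w (Suc p) (card M') (card (survivors w (Suc p) M' (slots ?d))) + 1 \<le>
        real w - real p + rest W w (card (survivors w p ?M sl))"
        using rest_mono by (simp add: steps_left_def)
    qed (use W True in auto)
  next
    case False
    then have pw: "w = Suc p" using W by simp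
    let ?W = "if 1 < w then W else 2 * W" and ?w = "if 1 < w then shrink w else 2 * W"
    show thesis
    proof (rule that[of ?W ?w 0])
      fix i assume i: "i \<in> ?M"
      then have "saw_next \<beta> (u i) (saw_of (?c i)) = Sawtooth ?W ?w 0 0"
        using cm[OF i] False by (simp add: saw_next_def shrink_def)
      then show "outer (saw_next \<beta> (u i) (saw_of (?c i))) = ?W \<and>
        width (saw_next \<beta> (u i) (saw_of (?c i))) = ?w \<and> pos (saw_next \<beta> (u i) (saw_of (?c i))) = 0 \<and>
        of_bool (i \<in> T) + saw_pot (saw_next \<beta> (u i) (saw_of (?c i))) \<le> of_bool (p \<le> sl i) + early_next W w"
        by (auto simp: saw_pot_def T_def early_next_def)
    next
      \<comment> \<open>At the last position p = w - 1 a lone slot that has not passed can only be p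
        itself, so whoever is still active is a survivor.\<close>
      have "M' \<subseteq> survivors w p ?M sl"
      proof
        fix i assume "i \<in> M'"
        then have iM: "i \<in> ?M" "T \<noteq> {i}" unfolding M'_def succ by blast+
        have "\<not> (p \<le> sl i \<and> sl i < w \<and> (\<forall>j\<in>?M. sl j = sl i \<longrightarrow> j = i))"
        proof
          assume s: "p \<le> sl i \<and> sl i < w \<and> (\<forall>j\<in>?M. sl j = sl i \<longrightarrow> j = i)"
          then have "sl i = p" using pw by simp
          then show False using lone[of i] s iM by blast
        qed
        then show "i \<in> survivors w p ?M sl" using iM by (simp add: survivors_def)
      qed
      then have "card M' \<le> card (survivors w p ?M sl)"
        by (intro card_mono) (auto simp: survivors_def)
      then have "rest W w (card M') \<le> rest W w (card (survivors w p ?M sl))" by (rule rest_mono)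
      then show "steps_left ?W ?w 0 (card M') (card (survivors ?w 0 M' (slots ?d))) + 1 \<le>
        real w - real p + rest W w (card (survivors w p ?M sl))"
        using pw by (simp add: steps_left_def rest_def split: if_splits)
    qed (use W shrink_ge_1[of w] in auto)
  qed
  have mem: "?d i = Off \<or> (\<exists>z. ?d i = Member (Suc t) z \<and> outer z = W' \<and> width z = w' \<and> pos z = p')"
    if "i \<in> ?M" for i
    using dm[OF that] nx[OF that] by auto
  have rcv': "received ?a i \<noteq> Some Anybody_out_there \<and> (received ?a i = None \<longrightarrow> odd t \<or> probe_round t)" for i
    using rcv t by blast
  note N = dissemination_next[OF D dl rcv' mem W']
  have D1: "dissemination ?d l (Suc t) W' w' p'" by (rule N(1))
  have D2: "members ?d = M'"
  proof -
    have "members ?d = {i \<in> ?M. ?d i \<noteq> Off}" by (rule N(2))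
    also have "\<dots> = M'" unfolding M'_def
    proof (rule Collect_cong)
      show "i \<in> ?M \<and> ?d i \<noteq> Off \<longleftrightarrow> i \<in> ?M \<and> \<not> successful ?a i" for i
        by (cases "i \<in> ?M") (simp_all add: dm)
    qed
    finally show ?thesis .
  qed
  have D3: "pot (?d i) = pot (?c i)" if "i \<notin> ?M" for i by (rule N(3)) (simp_all add: that)
  let ?e = "\<lambda>i. if i \<in> ?M then of_bool (p \<le> sl i) + early_next W w + real (probes k t) else pot (?c i)"
  have "of_bool (i \<in> T) + pot (?d i) \<le> ?e i" if "i < k" for i
  proof (cases "i \<in> ?M")
    case True
    have "0 \<le> early_next W w" using W by (intro early_next_nonneg) auto
    moreover have "probes k (Suc t) = probes k t" using probes_Suc[of k t] np by simp
    ultimately show ?thesis using True nx[OF True] dm[OF True] by (auto simp: T_def)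
  next
    case False
    then show ?thesis using D3[OF False] by (simp add: T_def)
  qed
  then have "(\<Sum>i<k. of_bool (i \<in> T) + pot (?d i)) \<le> (\<Sum>i<k. ?e i)" by (intro sum_mono) auto
  then have S: "real (card {i. i < k \<and> ?a i \<noteq> None}) + (\<Sum>i<k. pot (?d i)) \<le> (\<Sum>i<k. ?e i)"
    unfolding aT real_card_filter by (simp add: sum.distrib)
  have "0 \<le> rest W w (card (survivors w p ?M sl))" using W by (intro rest_nonneg) auto
  moreover have "real p + 1 \<le> real w" using W by simp
  moreover have "tail (Suc t) \<le> real (Suc t) + 4" by (rule tail_le) simp
  ultimately have "global_pot (Suc t) W' w' p' (card M') (card (survivors w' p' M' (slots ?d))) \<le>
      probe_credit t + real t + 4 + 8 * (real w - real p + rest W w (card (survivors w p ?M sl)))"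
    using st np t probe_credit_nonneg[of t] by (simp add: global_pot_def)
  then have "real (card {i. i < k \<and> ?a i \<noteq> None}) +
      ((\<Sum>i<k. pot (?d i)) + global_pot (Suc t) W' w' p' (card (members ?d)) (card (survivors w' p' (members ?d) (slots ?d))))
      \<le> drawn_pot ?c t W w p sl"
    using S unfolding D2 drawn_pot_def by linarith
  then show ?thesis using certified.dissemination[OF D1] unfolding sl_def by blast
qed

end

subsection \<open>Expectations\<close>

context adaptive
begin

lemma current_history_step [simp]: "current (history_step q \<beta> k adv h u) = next_states q \<beta> k adv u h"
  by (simp add: history_step_def)

lemma attempts_plus_le:
  assumes R: "\<forall>h v. certified (current h) v \<longrightarrow> R h \<le> ennreal v"
    and "certified (next_states q \<beta> k adv u h) v"
    and "real (card {i. i < k \<and> actions q u h i \<noteq> None}) + v \<le> x"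
  shows "of_nat (card {i. i < k \<and> actions q u h i \<noteq> None}) + R (history_step q \<beta> k adv h u) \<le> ennreal x"
proof -
  have "of_nat (card {i. i < k \<and> actions q u h i \<noteq> None}) + R (history_step q \<beta> k adv h u) \<le>
      ennreal (real (card {i. i < k \<and> actions q u h i \<noteq> None})) + ennreal v"
    using assms(1,2) by (intro add_mono) (simp_all add: ennreal_of_nat_eq_real_of_nat)
  also have "\<dots> = ennreal (real (card {i. i < k \<and> actions q u h i \<noteq> None}) + v)"
    using certified_nonneg[OF assms(2)] by (simp add: ennreal_plus)
  also have "\<dots> \<le> ennreal x" using assms(3) by (rule ennreal_leI)
  finally show ?thesis .
qed

definition attempts_after :: "(history \<Rightarrow> ennreal) \<Rightarrow> history \<Rightarrow> (nat \<Rightarrow> real) \<Rightarrow> ennreal" where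
  "attempts_after R h u =
     of_nat (card {i. i < k \<and> actions q u h i \<noteq> None}) + R (history_step q \<beta> k adv h u)"

lemma young_rate_nonneg: "0 \<le> young_rate s"
  using rate_nonneg by (cases s) auto

fun election_rate :: "station \<Rightarrow> real" where
  "election_rate (Electing i) = rate i"
| "election_rate _ = 0"

lemma election_rate_sum:
  assumes c: "quiet c"
  defines "E \<equiv> {i. i < k \<and> is_electing (c i)}"
  shows "(\<Sum>i\<in>E. election_rate (c i)) \<le> 2 * (\<Sum>i<k. young_rate (c i)) +
    4 powr (2 * q) * round_coins.prob {u. \<exists>!i. i \<in> E \<and> u i < election_rate (c i)}"
proof -
  define s where "s = (\<Sum>i\<in>E. election_rate (c i))"
  define y where "y = (\<Sum>i<k. young_rate (c i))"
  let ?P = "round_coins.prob {u. \<exists>!i. i \<in> E \<and> u i < election_rate (c i)}"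
  have E: "finite E" "E \<subseteq> {..<k}" by (auto simp: E_def)
  have bounds: "0 \<le> election_rate (c i) \<and> election_rate (c i) \<le> 1 / 2" for i
    using rate_nonneg rate_le_half by (cases "c i") auto
  then have s0: "0 \<le> s" unfolding s_def by (intro sum_nonneg) auto
  have P: "s * 4 powr (- s) \<le> ?P"
    unfolding s_def using E bounds by (intro prob_unique_success) auto
  have "y = (\<Sum>i\<in>E. young_rate (c i))"
    unfolding y_def
  proof (rule sum.mono_neutral_right)
    show "\<forall>i\<in>{..<k} - E. young_rate (c i) = 0"
    proof
      fix i assume "i \<in> {..<k} - E"
      then have "\<not> is_electing (c i)" by (auto simp: E_def)
      then show "young_rate (c i) = 0" by (cases "c i") auto
    qed
  qed (use E in auto)
  moreover have "election_rate (c i) \<le> young_rate (c i) + q / real k" for i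
    using q k rate_old by (cases "c i") auto
  then have "s \<le> (\<Sum>i\<in>E. young_rate (c i) + q / real k)" unfolding s_def by (rule sum_mono)
  ultimately have "s \<le> y + real (card E) * (q / real k)" by (simp add: sum.distrib)
  moreover have "card E \<le> k" using card_mono[OF _ E(2)] by simp
  then have "real (card E) * (q / real k) \<le> real k * (q / real k)"
    using q by (intro mult_right_mono) auto
  ultimately have sy: "s \<le> y + q" using k by simp
  \<comment> \<open>Old stations contribute at most q in total. If y \<ge> q the young ones cover
    them; otherwise s < 2 * q, and the probability of a success is at least s * 4 powr (- 2 * q),
    the origin of the power in \<open>base\<close>.\<close>
  have "s \<le> 2 * y + 4 powr (2 * q) * ?P"
  proof (cases "q \<le> y")
    case True
    then show ?thesis using sy by (simp add: add_increasing2)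
  next
    case False
    then have "s \<le> 2 * q" using sy by simp
    then have "1 \<le> (4::real) powr (2 * q - s)" by (intro ge_one_powr_ge_zero) auto
    then have "1 \<le> 4 powr (2 * q) * 4 powr (- s)" by (simp flip: powr_add)
    then have "s * 1 \<le> s * (4 powr (2 * q) * 4 powr (- s))" using s0 by (rule mult_left_mono)
    also have "\<dots> = 4 powr (2 * q) * (s * 4 powr (- s))" by simp
    also have "\<dots> \<le> 4 powr (2 * q) * ?P" using P by (intro mult_left_mono) auto
    finally have "s \<le> 4 powr (2 * q) * ?P" by simp
    moreover have "0 \<le> y"
      unfolding y_def by (intro sum_nonneg young_rate_nonneg)
    ultimately show ?thesis by simp
  qed
  then show ?thesis by (simp add: s_def y_def)
qed

lemma quiet_expectation:
  assumes R: "\<forall>h v. certified (current h) v \<longrightarrow> R h \<le> ennreal v" and c: "quiet (current h)"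
  shows "(\<integral>\<^sup>+u. attempts_after R h u \<partial>round_coins) \<le> ennreal (\<Sum>i<k. pot (current h i))"
proof -
  let ?c = "current h"
  define E where "E = {i. i < k \<and> is_electing (?c i)}"
  define S where "S = (\<Sum>i<k. pot (?c i) - 2 * young_rate (?c i))"
  define f where "f u = S + (\<Sum>i\<in>E. indicator {u. u i < election_rate (?c i)} u) -
      4 powr (2 * q) * indicator {u. \<exists>!i. i \<in> E \<and> u i < election_rate (?c i)} u" for u :: "nat \<Rightarrow> real"
  have E: "finite E" by (simp add: E_def)
  have act: "(i < k \<and> actions q u h i \<noteq> None) \<longleftrightarrow> (i \<in> E \<and> u i < election_rate (?c i))" for i u
  proof (cases "i < k")
    case True
    then consider "bystander (?c i)" | e where "?c i = Electing e"
      using c by (metis is_electing.elims(2) quiet_def)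
    then show ?thesis
    proof cases
      case 1
      then have "actions q u h i = None" "\<not> is_electing (?c i)" by (cases "?c i"; simp add: actions_def)+
      then show ?thesis by (simp add: E_def)
    next
      case 2
      then show ?thesis using True by (simp add: E_def actions_def rate_def)
    qed
  qed (simp add: E_def)
  have sets: "{u. u i < election_rate (?c i)} \<in> sets round_coins" for i
  proof -
    have "{u \<in> space round_coins. u i < election_rate (?c i)} \<in> sets round_coins" by measurable
    then show ?thesis by simp
  qed
  have uniq: "{u. \<exists>!i. i \<in> E \<and> u i < election_rate (?c i)} \<in> sets round_coins"
  proof -
    have "(\<exists>!i. i \<in> E \<and> u i < election_rate (?c i)) \<longleftrightarrow>
        (\<exists>i\<in>E. \<forall>j\<in>E. u j < election_rate (?c j) \<longleftrightarrow> j = i)" for u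
      by metis
    then have "{u. \<exists>!i. i \<in> E \<and> u i < election_rate (?c i)} =
        {u \<in> space round_coins. \<exists>i\<in>E. \<forall>j\<in>E. u j < election_rate (?c j) \<longleftrightarrow> j = i}"
      by (simp only: space_round_coins UNIV_I simp_thms)
    also have "\<dots> \<in> sets round_coins" using E by measurable
    finally show ?thesis .
  qed
  have f: "\<exists>v. certified (next_states q \<beta> k adv u h) v \<and>
      real (card {i. i < k \<and> actions q u h i \<noteq> None}) + v \<le> f u" for u
  proof -
    have "(\<Sum>i<k. of_bool (actions q u h i \<noteq> None)) = (\<Sum>i\<in>E. indicator {u. u i < election_rate (?c i)} u :: real)"
    proof (rule sum.mono_neutral_cong_right)
      show "\<forall>i\<in>{..<k} - E. of_bool (actions q u h i \<noteq> None) = (0::real)"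
      proof
        fix i assume "i \<in> {..<k} - E"
        then have "\<not> actions q u h i \<noteq> None" using act[of i u] by blast
        then show "of_bool (actions q u h i \<noteq> None) = (0::real)" by simp
      qed
      show "of_bool (actions q u h i \<noteq> None) = (indicator {u. u i < election_rate (?c i)} u :: real)" if "i \<in> E" for i
      proof -
        have "actions q u h i \<noteq> None \<longleftrightarrow> u i < election_rate (?c i)"
          using act[of i u] that by (simp add: E_def)
        then show ?thesis by (simp add: indicator_def)
      qed
    qed (auto simp: E_def)
    moreover have "of_bool (\<exists>!i. i < k \<and> actions q u h i \<noteq> None) =
        (indicator {u. \<exists>!i. i \<in> E \<and> u i < election_rate (?c i)} u :: real)"
      unfolding act by (simp add: indicator_def)
    ultimately show ?thesis using quiet_round[OF c, of u] by (simp only: f_def S_def)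
  qed
  have nonneg: "0 \<le> f u" for u
  proof -
    obtain v where v: "certified (next_states q \<beta> k adv u h) v"
      "real (card {i. i < k \<and> actions q u h i \<noteq> None}) + v \<le> f u"
      using f by blast
    have "0 \<le> v" using v(1) by (rule certified_nonneg)
    moreover have "0 \<le> real (card {i. i < k \<and> actions q u h i \<noteq> None})" by simp
    ultimately show ?thesis using v(2) by linarith
  qed
  have I: "integrable round_coins (\<lambda>u. S)"
    "integrable round_coins (\<lambda>u. \<Sum>i\<in>E. indicator {u. u i < election_rate (?c i)} u :: real)"
    "integrable round_coins (\<lambda>u. 4 powr (2 * q) * indicator {u. \<exists>!i. i \<in> E \<and> u i < election_rate (?c i)} u)"
    by (simp, intro Bochner_Integration.integrable_sum integrable_round_indicator sets, intro integrable_mult_right integrable_round_indicator uniq)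
  show ?thesis
    unfolding attempts_after_def
  proof (rule nn_integral_le_ennreal[where f = f])
    show "integrable round_coins f"
      unfolding f_def by (intro Bochner_Integration.integrable_diff Bochner_Integration.integrable_add I)
    show "of_nat (card {i. i < k \<and> actions q u h i \<noteq> None}) + R (history_step q \<beta> k adv h u) \<le> ennreal (f u)" for u
    proof -
      obtain v where "certified (next_states q \<beta> k adv u h) v"
        "real (card {i. i < k \<and> actions q u h i \<noteq> None}) + v \<le> f u"
        using f by blast
      then show ?thesis by (rule attempts_plus_le[OF R])
    qed
    have "integral\<^sup>L round_coins f = S + (\<Sum>i\<in>E. round_coins.prob {u. u i < election_rate (?c i)}) -
        4 powr (2 * q) * round_coins.prob {u. \<exists>!i. i \<in> E \<and> u i < election_rate (?c i)}"
    proof -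
      have "integral\<^sup>L round_coins f = integral\<^sup>L round_coins (\<lambda>u. S + (\<Sum>i\<in>E. indicator {u. u i < election_rate (?c i)} u)) -
          integral\<^sup>L round_coins (\<lambda>u. 4 powr (2 * q) * indicator {u. \<exists>!i. i \<in> E \<and> u i < election_rate (?c i)} u)"
        unfolding f_def by (intro Bochner_Integration.integral_diff Bochner_Integration.integrable_add I)
      also have "integral\<^sup>L round_coins (\<lambda>u. S + (\<Sum>i\<in>E. indicator {u. u i < election_rate (?c i)} u)) =
          integral\<^sup>L round_coins (\<lambda>u. S) + integral\<^sup>L round_coins (\<lambda>u. \<Sum>i\<in>E. indicator {u. u i < election_rate (?c i)} u)"
        by (intro Bochner_Integration.integral_add I)
      also have "integral\<^sup>L round_coins (\<lambda>u. \<Sum>i\<in>E. indicator {u. u i < election_rate (?c i)} u) =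
          (\<Sum>i\<in>E. integral\<^sup>L round_coins (indicator {u. u i < election_rate (?c i)}) :: real)"
        by (intro Bochner_Integration.integral_sum integrable_round_indicator sets)
      finally show ?thesis by simp
    qed
    also have "(\<Sum>i\<in>E. round_coins.prob {u. u i < election_rate (?c i)}) = (\<Sum>i\<in>E. election_rate (?c i))"
    proof (rule sum.cong)
      fix i
      have "0 \<le> election_rate (?c i)" "election_rate (?c i) \<le> 1"
        using rate_nonneg rate_le_half[THEN order_trans] by (cases "?c i"; simp)+
      then show "round_coins.prob {u. u i < election_rate (?c i)} = election_rate (?c i)"
        using prob_round_coins[of "{i}" "\<lambda>i. {..<election_rate (?c i)}"] prob_unit_less by simp
    qed simp
    finally show "integral\<^sup>L round_coins f \<le> (\<Sum>i<k. pot (?c i))"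
      using election_rate_sum[OF c] unfolding S_def E_def
      by (simp add: sum_subtractf sum_distrib_left)
  qed (rule nonneg)
qed

text \<open>Only the third case depends on the draw: where \<open>fail\<close> is 1,
  \<open>later\<close> is already charged in full and no outcome exceeds it. Otherwise
  \<open>fail\<close> is linear in n, and the expected number of survivors is at most n^2 /
  w.\<close>

lemma expected_rest:
  assumes A: "finite A" "A \<noteq> {}" and W: "1 \<le> W" and w: "1 \<le> w"
  obtains f where "integrable round_coins f"
    "\<And>u. rest W w (card (survivors w 0 A (\<lambda>i. nat \<lfloor>u i * real w\<rfloor>))) \<le> f u"
    "integral\<^sup>L round_coins f \<le> duration W w (card A) - real w - late W"
proof -
  let ?n = "card A" and ?m = "\<lambda>u. card (survivors w 0 A (\<lambda>i. nat \<lfloor>u i * real w\<rfloor>))"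
  have n: "1 \<le> ?n" using A by (simp add: Suc_le_eq card_gt_0_iff)
  have m: "?m u \<le> ?n" for u using A by (intro card_survivors_le)
  consider "w = 1" | "1 < w" "real w \<le> ratio * real ?n" | "1 < w" "ratio * real ?n < real w"
    using w by linarith
  then show thesis
  proof cases
    case 1
    have "1 \<le> ratio * real ?n" using ratio_ge_2 n mult_mono[of 1 ratio 1 "real ?n"] by simp
    then have "fail w ?n = 1" using 1 by (simp add: fail_def)
    then have "later (2 * W) ?n \<le> duration W w ?n - real w - late W"
      using span_1[of W] 1 by (simp add: duration_def)
    moreover have "rest W w (?m u) \<le> later (2 * W) ?n" for u
      using 1 duration_le_later[of "2 * W" "?m u"] later_mono[OF m, of "2 * W" u] W by (simp add: rest_def)
    ultimately show thesis by (intro that[of "\<lambda>_. later (2 * W) ?n"]) simp_all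
  next
    case 2
    then have "fail w ?n = 1" by (simp add: fail_def)
    then have "span W (shrink w) + later (2 * W) ?n \<le> duration W w ?n - real w - late W"
      using span_shrink[OF 2(1), of W] by (simp add: duration_def)
    moreover have "rest W w (?m u) \<le> span W (shrink w) + later (2 * W) ?n" for u
    proof -
      have "fail (shrink w) (?m u) * later (2 * W) (?m u) \<le> 1 * later (2 * W) ?n"
        by (intro mult_mono fail_le_1 later_mono m later_nonneg) simp
      then show ?thesis using 2 by (simp add: rest_def duration_def)
    qed
    ultimately show thesis
      by (intro that[of "\<lambda>_. span W (shrink w) + later (2 * W) ?n"]) simp_all
  next
    case 3
    define X where "X u = (\<Sum>i\<in>A. of_bool (w \<le> nat \<lfloor>u i * real w\<rfloor>) +
        (\<Sum>j\<in>A - {i}. of_bool (nat \<lfloor>u i * real w\<rfloor> = nat \<lfloor>u j * real w\<rfloor>)) :: real)" for u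
    have X: "integrable round_coins X" "integral\<^sup>L round_coins X \<le> real ?n ^ 2 / real w"
      using expected_collisions[OF A(1), of w] w unfolding X_def[abs_def] by auto
    define d where "d = ratio / real (shrink w) * later (2 * W) ?n"
    have d: "0 \<le> d" unfolding d_def using ratio_ge_2 later_nonneg by simp
    have s: "1 \<le> real (shrink w)" using shrink_ge_1[of w] by simp
    have "rest W w (?m u) \<le> span W (shrink w) + d * X u" for u
    proof -
      have "fail (shrink w) (?m u) \<le> ratio * real (?m u) / real (shrink w)"
        by (simp add: fail_def)
      also have "\<dots> \<le> ratio * X u / real (shrink w)"
        using survivors_le_collisions[OF A(1), of w "\<lambda>i. nat \<lfloor>u i * real w\<rfloor>"] ratio_ge_2
        unfolding X_def by (intro divide_right_mono mult_left_mono) auto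
      finally have fl: "fail (shrink w) (?m u) \<le> ratio * X u / real (shrink w)" .
      have "fail (shrink w) (?m u) * later (2 * W) (?m u) \<le> ratio * X u / real (shrink w) * later (2 * W) ?n"
        using fl fail_nonneg[of "shrink w" "?m u"] by (intro mult_mono later_mono m later_nonneg) auto
      then show ?thesis using 3 by (simp add: rest_def duration_def d_def field_simps)
    qed
    moreover have "span W (shrink w) + d * integral\<^sup>L round_coins X \<le> duration W w ?n - real w - late W"
    proof -
      \<comment> \<open>The supermartingale step: ratio * n < w \<le> ratio * shrink w yields n <
        shrink w, so n^2 / (w * shrink w) is at most n / w.\<close>
      have "ratio / real (shrink w) * (real ?n ^ 2 / real w) \<le> ratio * real ?n / real w"
      proof -
        have "(ratio * real ?n) * real ?n \<le> real w * real ?n"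
          using 3 by (intro mult_right_mono) auto
        also have "\<dots> \<le> (ratio * real (shrink w)) * real ?n"
          using shrink_ratio[OF w] by (intro mult_right_mono) auto
        finally show ?thesis using s w by (simp add: field_simps power2_eq_square)
      qed
      also have "\<dots> = fail w ?n" using 3 w by (simp add: fail_def field_simps)
      finally have "ratio / real (shrink w) * (real ?n ^ 2 / real w) * later (2 * W) ?n \<le> fail w ?n * later (2 * W) ?n"
        using later_nonneg by (intro mult_right_mono) auto
      moreover have "d * integral\<^sup>L round_coins X \<le> d * (real ?n ^ 2 / real w)"
        using X(2) d by (rule mult_left_mono)
      moreover have "d * (real ?n ^ 2 / real w) = ratio / real (shrink w) * (real ?n ^ 2 / real w) * later (2 * W) ?n"
        by (simp add: d_def)
      ultimately show ?thesis using span_shrink[OF 3(1), of W] by (simp add: duration_def)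
    qed
    ultimately show thesis using X(1)
      by (intro that[of "\<lambda>u. span W (shrink w) + d * X u"]) simp_all
  qed
qed

lemma sum_members:
  "(\<Sum>i<k. if i \<in> members c then f i else g i) =
    (\<Sum>i\<in>members c. f i) + (\<Sum>i\<in>{..<k} - members c. g i :: real)"
proof -
  have "members c \<subseteq> {..<k}" by (auto simp: members_def)
  then have "{..<k} \<inter> {i. i \<in> members c} = members c" "{..<k} \<inter> - {i. i \<in> members c} = {..<k} - members c"
    by auto
  then show ?thesis by (simp add: sum.If_cases)
qed

lemma odd_expectation:
  assumes R: "\<forall>h v. certified (current h) v \<longrightarrow> R h \<le> ennreal v"
    and D: "dissemination (current h) l t W w p" and M: "members (current h) \<noteq> {}" and t: "odd t"
  shows "(\<integral>\<^sup>+u. attempts_after R h u \<partial>round_coins) \<le> ennreal ((\<Sum>i<k. pot (current h i)) +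
      global_pot t W w p (card (members (current h)))
        (card (survivors w p (members (current h)) (slots (current h)))))"
    (is "_ \<le> ennreal ?v")
proof -
  let ?c = "current h"
  let ?M = "members ?c" and ?sl = "\<lambda>u i. saw_slot (u i) (saw_of (?c i))"
  have W: "2 \<le> W" "1 \<le> w" "p < w" using D by (auto simp: dissemination_def)
  have M0: "card ?M \<noteq> 0" using M by simp
  have Mk: "card ?M \<le> k"
    using card_mono[of "{..<k}" ?M] by (auto simp: members_def)
  have P: "(\<Sum>i<k. pot (?c i)) = (\<Sum>i\<in>?M. pot (?c i)) + (\<Sum>i\<in>{..<k} - ?M. pot (?c i))"
    using sum_members[where c = ?c and f = "\<lambda>i. pot (?c i)" and g = "\<lambda>i. pot (?c i)"] by simp
  have "\<exists>f. integrable round_coins f \<and> (\<forall>u. drawn_pot ?c t W w p (?sl u) \<le> f u) \<and>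
      integral\<^sup>L round_coins f \<le> ?v"
  proof (cases "p = 0")
    \<comment> \<open>Inside a window the slots are known, so \<open>drawn_pot\<close> is simply the
      present value.\<close>
    case False
    have sl: "?sl u i = slots ?c i" if "i \<in> ?M" for u i
      using dissemination_member[OF D that] False by (metis saw_slot_def slots_def)
    have "drawn_pot ?c t W w p (?sl u) = ?v" for u
    proof -
      have "survivors w p ?M (?sl u) = survivors w p ?M (slots ?c)"
        using sl by (intro survivors_cong)
      moreover have "of_bool (p \<le> ?sl u i) + early_next W w + real (probes k t) = pot (?c i)" if i: "i \<in> ?M" for i
      proof (rule dissemination_member[OF D i])
        fix z assume "?c i = Member t z" "outer z = W" "width z = w" "pos z = p" "saw_of (?c i) = z"
        then show ?thesis using sl[OF i, of u] False by (simp add: saw_pot_def slots_def)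
      qed
      ultimately show ?thesis
        using M0 t False by (simp add: drawn_pot_def sum_members P global_pot_def steps_left_def)
    qed
    then show ?thesis by (intro exI[of _ "\<lambda>_. ?v"]) simp
  next
    case True
    have sl: "?sl u i = nat \<lfloor>u i * real w\<rfloor>" if "i \<in> ?M" for u i
      using dissemination_member[OF D that] True by (metis saw_slot_def)
    obtain f where f: "integrable round_coins f"
      "\<And>u. rest W w (card (survivors w 0 ?M (\<lambda>i. nat \<lfloor>u i * real w\<rfloor>))) \<le> f u"
      "integral\<^sup>L round_coins f \<le> duration W w (card ?M) - real w - late W"
      using expected_rest[of ?M W w] M W by auto
    define B where "B = (\<Sum>i\<in>?M. 1 + early_next W w + real (probes k t)) + (\<Sum>i\<in>{..<k} - ?M. pot (?c i)) +
      probe_credit t + real t + 4 + 8 * real w"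
    have "drawn_pot ?c t W w p (?sl u) \<le> B + 8 * f u" for u
    proof -
      have "survivors w p ?M (?sl u) = survivors w 0 ?M (\<lambda>i. nat \<lfloor>u i * real w\<rfloor>)"
        unfolding True using sl by (intro survivors_cong)
      moreover have "(\<Sum>i\<in>?M. of_bool (p \<le> ?sl u i) + early_next W w + real (probes k t)) \<le>
          (\<Sum>i\<in>?M. 1 + early_next W w + real (probes k t))"
        by (intro sum_mono) auto
      ultimately show ?thesis
        using f(2)[of u] True unfolding drawn_pot_def sum_members B_def by simp
    qed
    \<comment> \<open>The \<open>late W\<close> that \<open>duration\<close> sets aside for this
      window is what \<open>early_step\<close> asks for; the factor 8 provides more than
      enough.\<close>
    moreover have "B + 8 * integral\<^sup>L round_coins f \<le> ?v"
    proof -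
      have "(\<Sum>i\<in>?M. pot (?c i)) = (\<Sum>i\<in>?M. early W w + real (probes k t))"
      proof (rule sum.cong[OF refl])
        fix i assume "i \<in> ?M"
        then show "pot (?c i) = early W w + real (probes k t)"
          using True by (elim dissemination_member[OF D]) (simp add: saw_pot_def)
      qed
      moreover have "real (card ?M) * (1 + early_next W w) \<le> real (card ?M) * early W w + late W"
        using W Mk by (intro early_step) auto
      ultimately have "B \<le> (\<Sum>i<k. pot (?c i)) + late W + probe_credit t + real t + 4 + 8 * real w"
        unfolding P B_def by (simp add: algebra_simps)
      then show ?thesis
        using f(3) late_nonneg[of W] True M0 t by (simp add: global_pot_def steps_left_def)
    qed
    ultimately show ?thesis using f(1) by (intro exI[of _ "\<lambda>u. B + 8 * f u"]) simp
  qed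
  then obtain f where f: "integrable round_coins f" "\<And>u. drawn_pot ?c t W w p (?sl u) \<le> f u"
    "integral\<^sup>L round_coins f \<le> ?v" by blast
  have ex: "\<exists>v. certified (next_states q \<beta> k adv u h) v \<and>
      real (card {i. i < k \<and> actions q u h i \<noteq> None}) + v \<le> f u" for u
    using odd_round[OF D M t, of u] f(2)[of u] order_trans by blast
  show ?thesis
    unfolding attempts_after_def
  proof (rule nn_integral_le_ennreal[OF f(1) _ _ f(3)])
    fix u
    obtain v where v: "certified (next_states q \<beta> k adv u h) v"
      "real (card {i. i < k \<and> actions q u h i \<noteq> None}) + v \<le> f u"
      using ex by blast
    then show "of_nat (card {i. i < k \<and> actions q u h i \<noteq> None}) + R (history_step q \<beta> k adv h u) \<le> ennreal (f u)"
      by (rule attempts_plus_le[OF R])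
    have "0 \<le> v" using v(1) by (rule certified_nonneg)
    moreover have "0 \<le> real (card {i. i < k \<and> actions q u h i \<noteq> None})" by simp
    ultimately show "0 \<le> f u" using v(2) by linarith
  qed
qed

lemma deterministic_expectation:
  assumes R: "\<forall>h v. certified (current h) v \<longrightarrow> R h \<le> ennreal v"
    and ex: "\<And>u. \<exists>v. certified (next_states q \<beta> k adv u h) v \<and>
      real (card {i. i < k \<and> actions q u h i \<noteq> None}) + v \<le> x"
  shows "(\<integral>\<^sup>+u. attempts_after R h u \<partial>round_coins) \<le> ennreal x"
proof -
  have "attempts_after R h u \<le> ennreal x" for u
  proof -
    obtain v where "certified (next_states q \<beta> k adv u h) v"
      "real (card {i. i < k \<and> actions q u h i \<noteq> None}) + v \<le> x"
      using ex by blast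
    then show ?thesis unfolding attempts_after_def by (rule attempts_plus_le[OF R])
  qed
  then have "(\<integral>\<^sup>+u. attempts_after R h u \<partial>round_coins) \<le> (\<integral>\<^sup>+u. ennreal x \<partial>round_coins)"
    by (intro nn_integral_mono)
  then show ?thesis using round_coins.emeasure_space_1 by simp
qed

lemma certified_expectation:
  assumes R: "\<forall>h v. certified (current h) v \<longrightarrow> R h \<le> ennreal v" and c: "certified (current h) v"
  shows "(\<integral>\<^sup>+u. attempts_after R h u \<partial>round_coins) \<le> ennreal v"
  using c
proof cases
  case quiet
  then show ?thesis using quiet_expectation[OF R] by simp
next
  case (dissemination l t W w p)
  show ?thesis
  proof (cases "members (current h) = {}")
    case True
    have "(\<integral>\<^sup>+u. attempts_after R h u \<partial>round_coins) \<le> ennreal ((\<Sum>i<k. pot (current h i)) + tail t)"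
      using idle_round[OF dissemination(2) True] by (intro deterministic_expectation[OF R])
    then show ?thesis using True by (simp add: dissemination(1) global_pot_def)
  next
    case False
    show ?thesis
    proof (cases "even t")
      case True
      show ?thesis unfolding dissemination(1)
        using even_round[OF dissemination(2) False True] by (intro deterministic_expectation[OF R])
    next
      case odd: False
      show ?thesis unfolding dissemination(1) using dissemination(2) False odd
        by (rule odd_expectation[OF R])
    qed
  qed
qed

section \<open>Iteration over the rounds\<close>

primrec future_attempts :: "nat \<Rightarrow> history \<Rightarrow> ennreal" where
  "future_attempts 0 h = 0"
| "future_attempts (Suc n) h = (\<integral>\<^sup>+u. attempts_after (future_attempts n) h u \<partial>round_coins)"

text \<open>The horizon is finite, so the induction starts from 0 and does not have to know that the
  execution ends.\<close>

lemma future_attempts_le: "certified (current h) v \<Longrightarrow> future_attempts n h \<le> ennreal v"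
proof (induction n arbitrary: h v)
  case (Suc n)
  have "\<forall>h v. certified (current h) v \<longrightarrow> future_attempts n h \<le> ennreal v" using Suc.IH by blast
  then show ?case using Suc.prems unfolding future_attempts.simps by (rule certified_expectation)
qed simp

text \<open>Reading the attempts off the head of the next history makes them a function of a
  countably valued variable, hence measurable.\<close>

lemma attempts_in_round_eq:
  "attempts_in_round q \<beta> k adv \<omega> t = card {i. i < k \<and> fst (hd (run q \<beta> k adv \<omega> (Suc t))) i \<noteq> None}"
  by (simp add: attempts_in_round_def Let_def)

lemma measurable_attempts [measurable]: "(\<lambda>\<omega>. of_nat (attempts_in_round q \<beta> k adv \<omega> t) :: ennreal) \<in> borel_measurable coins"
  unfolding attempts_in_round_eq by (rule measurable_compose[OF measurable_run_coins]) simp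

lemma nn_integral_future_attempts:
  "(\<integral>\<^sup>+\<omega>. future_attempts (Suc n) (run q \<beta> k adv \<omega> t) \<partial>coins) =
    (\<integral>\<^sup>+\<omega>. of_nat (attempts_in_round q \<beta> k adv \<omega> t) \<partial>coins) +
    (\<integral>\<^sup>+\<omega>. future_attempts n (run q \<beta> k adv \<omega> (Suc t)) \<partial>coins)"
proof -
  have "attempts_after (future_attempts n) h \<in> borel_measurable round_coins" if "h \<in> histories k" for h
  proof -
    have "attempts_after (future_attempts n) h = (\<lambda>u. (\<lambda>h'. of_nat (card {i. i < k \<and> fst (hd h') i \<noteq> None}) +
        future_attempts n h') (history_step q \<beta> k adv h u))"
      by (simp add: attempts_after_def fun_eq_iff history_step_def)
    also have "\<dots> \<in> borel_measurable round_coins"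
      by (rule measurable_compose[OF measurable_history_step[OF that]]) simp
    finally show ?thesis .
  qed
  then have "(\<integral>\<^sup>+\<omega>. future_attempts (Suc n) (run q \<beta> k adv \<omega> t) \<partial>coins) =
      (\<integral>\<^sup>+\<omega>. attempts_after (future_attempts n) (run q \<beta> k adv \<omega> t) (\<lambda>i. \<omega> (t, i)) \<partial>coins)"
    by (simp add: nn_integral_coins_split)
  also have "\<dots> = (\<integral>\<^sup>+\<omega>. of_nat (attempts_in_round q \<beta> k adv \<omega> t) + future_attempts n (run q \<beta> k adv \<omega> (Suc t)) \<partial>coins)"
    unfolding run_Suc by (simp add: attempts_after_def attempts_in_round_def)
  also have "\<dots> = (\<integral>\<^sup>+\<omega>. of_nat (attempts_in_round q \<beta> k adv \<omega> t) \<partial>coins) +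
      (\<integral>\<^sup>+\<omega>. future_attempts n (run q \<beta> k adv \<omega> (Suc t)) \<partial>coins)"
    by (intro nn_integral_add measurable_attempts measurable_compose[OF measurable_run_coins]) simp
  finally show ?thesis .
qed

lemma sum_attempts:
  "(\<Sum>s<n. \<integral>\<^sup>+\<omega>. of_nat (attempts_in_round q \<beta> k adv \<omega> (t + s)) \<partial>coins) =
    (\<integral>\<^sup>+\<omega>. future_attempts n (run q \<beta> k adv \<omega> t) \<partial>coins)"
proof (induction n arbitrary: t)
  case (Suc n)
  show ?case
    unfolding sum.lessThan_Suc_shift nn_integral_future_attempts
    using Suc[of "Suc t"] by simp
qed simp

lemma expected_attempts_le: "expected_attempts q \<beta> k adv \<le> ennreal (real k * (base + young 0))"
proof -
  interpret coins: prob_space coins by (rule prob_space_coins)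
  have "quiet (\<lambda>_. Asleep)" by (simp add: quiet_def)
  from certified.quiet[OF this] have "certified (current []) (real k * (base + young 0))" by simp
  then have F: "future_attempts n [] \<le> ennreal (real k * (base + young 0))" for n
    by (rule future_attempts_le)
  have "expected_attempts q \<beta> k adv = (\<Sum>t. \<integral>\<^sup>+\<omega>. of_nat (attempts_in_round q \<beta> k adv \<omega> t) \<partial>coins)"
    unfolding expected_attempts_def total_attempts_def by (intro nn_integral_suminf measurable_attempts)
  also have "\<dots> = (SUP n. \<Sum>t<n. \<integral>\<^sup>+\<omega>. of_nat (attempts_in_round q \<beta> k adv \<omega> t) \<partial>coins)"
    by (rule suminf_eq_SUP)
  also have "\<dots> \<le> ennreal (real k * (base + young 0))"
  proof (rule SUP_least)
    fix n
    show "(\<Sum>t<n. \<integral>\<^sup>+\<omega>. of_nat (attempts_in_round q \<beta> k adv \<omega> t) \<partial>coins) \<le> ennreal (real k * (base + young 0))"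
      using sum_attempts[where n = n and t = 0] F[of n] coins.emeasure_space_1 by simp
  qed
  finally show ?thesis .
qed

text \<open>Built from \<open>q\<close> and \<beta> only, since the constant has to be chosen before
  k. Here 3 + 5 * log_slope bounds \<open>early 2 2\<close>, 1 + 4 * q bounds
  \<open>young 0\<close>, and 21 is the 20 of \<open>base\<close> plus 1 for \<open>probes\<close>;
  the remaining terms are those of \<open>base\<close>.\<close>

definition attempts_factor :: real where
  "attempts_factor = 4 powr (2 * q) + (3 + 5 * log_slope) + 21 +
     8 * (4 * cost_factor + 24 * cost_factor * ratio) + (1 + 4 * q)"

lemma attempts_factor_pos: "0 < attempts_factor"
proof -
  have "0 \<le> 4 powr (2 * q)" "0 \<le> 24 * cost_factor * ratio" "0 \<le> cost_factor" "0 \<le> log_slope"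
    using cost_factor_ge_1 ratio_ge_2 log_slope_ge_1 by auto
  then show ?thesis using q unfolding attempts_factor_def distrib_left by linarith
qed

lemma young_0_le: "young 0 \<le> 1 + 2 * q * (1 + ln (real k))"
proof -
  have "{0..<k} \<subseteq> insert 0 {1..k}" by auto
  then have "(\<Sum>j\<in>{0..<k}. rate j) \<le> (\<Sum>j\<in>insert 0 {1..k}. rate j)"
    using rate_nonneg by (intro sum_mono2) auto
  also have "\<dots> = rate 0 + (\<Sum>j\<in>{1..k}. rate j)" by simp
  also have "\<dots> \<le> 1 / 2 + (\<Sum>j\<in>{1..k}. q * (1 / real j))"
    using q by (intro add_mono sum_mono rate_le_half) (auto simp: rate_def intro!: mult_left_mono divide_left_mono)
  also have "\<dots> \<le> 1 / 2 + q * (1 + ln (real k))"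
    using q k sum_inverse_le[of k] unfolding sum_distrib_left[symmetric]
    by (intro add_left_mono mult_left_mono) auto
  finally show ?thesis by (simp add: young_def algebra_simps)
qed

text \<open>Only \<open>early 2 2\<close> is of order log^2; everything else is at most logarithmic.
  As log 2 k \<ge> 1 for k \<ge> 2, lower powers and constants are absorbed.\<close>

lemma base_young_le: "base + young 0 \<le> attempts_factor * (log 2 (real k))\<^sup>2"
proof -
  define L where "L = log 2 (real k)"
  have L: "1 \<le> L" using k by (simp add: L_def)
  then have L2: "L \<le> L\<^sup>2" "1 \<le> L\<^sup>2" by (simp_all add: self_le_power one_le_power)
  have sl: "1 \<le> log_slope" by (rule log_slope_ge_1)
  have kL: "log 2 (real (k^2)) = 2 * L" using k by (simp add: L_def log_nat_power)
  have "2 \<le> k^2" using k power2_nat_le_imp_le[of 2 k] by (metis le_trans power2_nat_le_eq_le self_le_power one_le_numeral pos2 le_square power2_eq_square)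
  then have "early 2 2 = 1 + log_slope + (2 * L - 1) * (1 + log_slope * (2 * L))"
    unfolding early_def windows_def kL by simp
  also have "\<dots> = 2 * L - log_slope * 2 * L + 4 * log_slope * L\<^sup>2 + log_slope"
    by (simp add: algebra_simps power2_eq_square)
  also have "\<dots> \<le> 3 * L\<^sup>2 + 5 * log_slope * L\<^sup>2"
  proof -
    have "0 \<le> log_slope * L" "log_slope * 1 \<le> log_slope * L\<^sup>2"
      using L L2 sl by (simp, intro mult_left_mono) auto
    then show ?thesis using L2 L sl by linarith
  qed
  finally have e: "early 2 2 \<le> (3 + 5 * log_slope) * L\<^sup>2" by (simp add: algebra_simps)
  have p: "real (probes k 1) \<le> L\<^sup>2" using probes_le[of k 1] k L2 by (simp add: L_def)
  have "ln (real k) = L * ln 2" using k by (simp add: L_def log_def)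
  also have "\<dots> \<le> L * 1" using L ln_le_minus_one[of 2] by (intro mult_left_mono) auto
  finally have "1 + ln (real k) \<le> 2 * L\<^sup>2" using L2 by simp
  then have "2 * q * (1 + ln (real k)) \<le> 2 * q * (2 * L\<^sup>2)"
    using q by (intro mult_left_mono) auto
  then have y: "young 0 \<le> (1 + 4 * q) * L\<^sup>2" using young_0_le L2 by (simp add: algebra_simps)
  define X where "X = 4 powr (2 * q) + 20 + 8 * (4 * cost_factor + 24 * cost_factor * ratio)"
  have "0 \<le> X"
    using cost_factor_ge_1 ratio_ge_2 by (simp add: X_def)
  then have "X * 1 \<le> X * L\<^sup>2" using L2 by (intro mult_left_mono) auto
  moreover have "base = X + (early 2 2 + real (probes k 1))"
    by (simp add: base_def participation_def X_def)
  moreover have "attempts_factor * L\<^sup>2 = X * L\<^sup>2 + (3 + 5 * log_slope) * L\<^sup>2 + L\<^sup>2 + (1 + 4 * q) * L\<^sup>2"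
    by (simp add: attempts_factor_def X_def algebra_simps)
  ultimately show ?thesis using e p y unfolding L_def[symmetric] by linarith
qed

lemma expected_attempts_bound:
  "expected_attempts q \<beta> k adv \<le> ennreal (attempts_factor * (real k * (log 2 (real k))\<^sup>2))"
proof -
  have "real k * (base + young 0) \<le> real k * (attempts_factor * (log 2 (real k))\<^sup>2)"
    by (intro mult_left_mono base_young_le) simp
  also have "\<dots> = attempts_factor * (real k * (log 2 (real k))\<^sup>2)" by simp
  finally show ?thesis using expected_attempts_le by (meson ennreal_leI order_trans)
qed

end

theorem theorem6p4:
  shows "\<exists>q\<^sub>0 > (0::real). \<forall>q \<ge> q\<^sub>0. \<forall>\<beta>::real. 0 < \<beta> \<and> \<beta> < 1 \<longrightarrow>
    (\<exists>c > 0. \<forall>k \<ge> (2::nat). \<forall>adv :: adversary. activates_all q \<beta> k adv \<longrightarrow>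
       expected_attempts q \<beta> k adv \<le> ennreal (c * (real k * (log 2 (real k))\<^sup>2)))"
proof (rule exI[of _ 1], intro conjI allI impI)
  fix q \<beta> :: real
  assume q: "1 \<le> q" and \<beta>: "0 < \<beta> \<and> \<beta> < 1"
  have A: "adaptive q \<beta> k" if "2 \<le> k" for k
    using q \<beta> that by unfold_locales auto
  show "\<exists>c > 0. \<forall>k \<ge> (2::nat). \<forall>adv :: adversary. activates_all q \<beta> k adv \<longrightarrow>
       expected_attempts q \<beta> k adv \<le> ennreal (c * (real k * (log 2 (real k))\<^sup>2))"
  \<comment> \<open>Outside the locale this constant takes only \<open>q\<close> and \<beta> as
    parameters, so one witness serves all k and all adversaries.\<close>
  proof (intro exI[of _ "adaptive.attempts_factor q \<beta>"] conjI allI impI)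
    show "0 < adaptive.attempts_factor q \<beta>" using A[of 2] by (intro adaptive.attempts_factor_pos) auto
  next
    fix k :: nat and adv :: adversary
    assume "2 \<le> k"
    then show "expected_attempts q \<beta> k adv \<le>
        ennreal (adaptive.attempts_factor q \<beta> * (real k * (log 2 (real k))\<^sup>2))"
      by (intro adaptive.expected_attempts_bound A)
  qed
qed simp

end
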